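(* Let $(X,m,\sigma)$ be a (Hausdorff) topological median algebra such that every interval in $X$ is compact in the topology $\sigma$. Then: (1) If $\eta\colon X\hookrightarrow K$ is a proper median compactification of $(X,m,\sigma)$ and $K\in(T^m_2)$, then $X\in(T^m_2)$, $\sigma=\tau_{\mathrm m}$, and $\eta$ is canonically isomorphic to the minimal median compactification (MMC) of $(X,\tau_{\mathrm m})$. (2) If, in addition to the standing assumptions, $X$ has finite rank, then the following conditions are equivalent: (a) $(X,m,\sigma)$ admits a proper median compactification; (b) $\sigma=\tau_{\mathrm m}$. If these conditions hold, the MMC is the unique proper median compactification of $(X,m,\sigma)$ (up to isomorphism of compactifications).
   Context: A median algebra is a set $X$ with a ternary operation $m\colon X^3\to X$ that is symmetric in all variables and satisfies $m(a,b,b)=b$ and $m(m(a,x,b),x,c)=m(a,x,m(b,x,c))$. A topological median algebra is a Hausdorff topological space with a continuous median operation. Intervals: $[x,y]=\{z: m(x,y,z)=z\}$. A subalgebra is a chain if it carries a linear order $\le$ for which $m(a,b,c)=b$ whenever $a\le b\le c$. The rank of $X$ is the supremum of the $n$ for which $\{0,1\}^n$ (coordinatewise median) embeds as a median subalgebra (one-point algebra: rank $0$). Canonical retraction: $\phi_{u,v}(z)=m(u,z,v)$. Branches: $B^u_v=\{x: m(u,x,v)\neq v\}$. The median uniformity $\mathcal U_{\mathrm m}$ is the covering uniformity with uniform subbase all two-member covers $\{B^u_v,B^v_u\}$, where $[u,v]$ runs over all chain intervals with $u\neq v$: a cover belongs to $\mathcal U_{\mathrm m}$ iff it is refined by a finite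 common refinement of such covers. Its topology is $\tau_{\mathrm m}$. A median algebra $Y$ satisfies $(T^m_2)$ if for all $x\ne y$ in $Y$ there is a chain interval $[u,v]\subseteq Y$, $u\neq v$, with $\{\phi_{u,v}(x),\phi_{u,v}(y)\}=\{u,v\}$; equivalently $\mathcal U_{\mathrm m}(Y)$ is Hausdorff. In that case the MMC $\widehat Y$ is the Hausdorff completion of $(Y,\mathcal U_{\mathrm m})$, a compact Hausdorff topological median algebra with the unique continuous extension of $m$. A median compactification of a topological median algebra $X$ is a pair $(K,\eta)$ where $K$ is a compact Hausdorff topological median algebra and $\eta\colon X\to K$ is a continuous median-preserving map with dense image; it is proper if $\eta$ is a topological embedding. Isomorphism of compactifications means a homeomorphic median isomorphism commuting with the maps from $X$. *)

theory Defs
  imports "HOL-Analysis.Analysis"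
begin

section \<open>Median algebras\<close>

definition median_algebra :: "'a set \<Rightarrow> ('a \<Rightarrow> 'a \<Rightarrow> 'a \<Rightarrow> 'a) \<Rightarrow> bool" where
  "median_algebra X m \<longleftrightarrow>
     (\<forall>a\<in>X. \<forall>b\<in>X. \<forall>c\<in>X. m a b c \<in> X) \<and>
     (\<forall>a\<in>X. \<forall>b\<in>X. \<forall>c\<in>X. m a b c = m b a c \<and> m a b c = m a c b) \<and>
     (\<forall>a\<in>X. \<forall>b\<in>X. m a b b = b) \<and>
     (\<forall>a\<in>X. \<forall>b\<in>X. \<forall>c\<in>X. \<forall>x\<in>X. m (m a x b) x c = m a x (m b x c))"

definition median_interval ::
    "'a set \<Rightarrow> ('a \<Rightarrow> 'a \<Rightarrow> 'a \<Rightarrow> 'a) \<Rightarrow> 'a \<Rightarrow> 'a \<Rightarrow> 'a set" where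
  "median_interval X m x y = {z \<in> X. m x y z = z}"

definition median_subalgebra ::
    "'a set \<Rightarrow> ('a \<Rightarrow> 'a \<Rightarrow> 'a \<Rightarrow> 'a) \<Rightarrow> 'a set \<Rightarrow> bool" where
  "median_subalgebra X m C \<longleftrightarrow> C \<subseteq> X \<and> (\<forall>a\<in>C. \<forall>b\<in>C. \<forall>c\<in>C. m a b c \<in> C)"

definition median_chain ::
    "'a set \<Rightarrow> ('a \<Rightarrow> 'a \<Rightarrow> 'a \<Rightarrow> 'a) \<Rightarrow> 'a set \<Rightarrow> bool" where
  "median_chain X m C \<longleftrightarrow> median_subalgebra X m C \<and>
     (\<exists>r. linear_order_on C r \<and>
        (\<forall>a\<in>C. \<forall>b\<in>C. \<forall>c\<in>C. (a, b) \<in> r \<longrightarrow> (b, c) \<in> r \<longrightarrow> m a b c = b))"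

definition canonical_retraction ::
    "('a \<Rightarrow> 'a \<Rightarrow> 'a \<Rightarrow> 'a) \<Rightarrow> 'a \<Rightarrow> 'a \<Rightarrow> 'a \<Rightarrow> 'a" where
  "canonical_retraction m u v z = m u z v"

text \<open>\<^term>\<open>median_branch X m u v\<close> is $B^u_v$.\<close>

definition median_branch ::
    "'a set \<Rightarrow> ('a \<Rightarrow> 'a \<Rightarrow> 'a \<Rightarrow> 'a) \<Rightarrow> 'a \<Rightarrow> 'a \<Rightarrow> 'a set" where
  "median_branch X m u v = {x \<in> X. m u x v \<noteq> v}"

definition T2m :: "'a set \<Rightarrow> ('a \<Rightarrow> 'a \<Rightarrow> 'a \<Rightarrow> 'a) \<Rightarrow> bool" where
  "T2m Y m \<longleftrightarrow>
     (\<forall>x\<in>Y. \<forall>y\<in>Y. x \<noteq> y \<longrightarrow>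
        (\<exists>u\<in>Y. \<exists>v\<in>Y. u \<noteq> v \<and> median_chain Y m (median_interval Y m u v) \<and>
           {canonical_retraction m u v x, canonical_retraction m u v y} = {u, v}))"

text \<open>The cube $\{0,1\}^n$, with \<^typ>\<open>bool\<close> as two-element median algebra.\<close>

definition bool_median :: "bool \<Rightarrow> bool \<Rightarrow> bool \<Rightarrow> bool" where
  "bool_median a b c \<longleftrightarrow> (a \<and> b) \<or> (b \<and> c) \<or> (a \<and> c)"

definition cube :: "nat \<Rightarrow> (nat \<Rightarrow> bool) set" where
  "cube n = {..<n} \<rightarrow>\<^sub>E UNIV"

definition cube_median ::
    "nat \<Rightarrow> (nat \<Rightarrow> bool) \<Rightarrow> (nat \<Rightarrow> bool) \<Rightarrow> (nat \<Rightarrow> bool) \<Rightarrow> (nat \<Rightarrow> bool)" where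
  "cube_median n a b c = (\<lambda>i\<in>{..<n}. bool_median (a i) (b i) (c i))"

definition cube_embeds :: "'a set \<Rightarrow> ('a \<Rightarrow> 'a \<Rightarrow> 'a \<Rightarrow> 'a) \<Rightarrow> nat \<Rightarrow> bool" where
  "cube_embeds X m n \<longleftrightarrow>
     (\<exists>f. inj_on f (cube n) \<and> f ` cube n \<subseteq> X \<and>
        (\<forall>a\<in>cube n. \<forall>b\<in>cube n. \<forall>c\<in>cube n.
           f (cube_median n a b c) = m (f a) (f b) (f c)))"

definition median_rank :: "'a set \<Rightarrow> ('a \<Rightarrow> 'a \<Rightarrow> 'a \<Rightarrow> 'a) \<Rightarrow> enat" where
  "median_rank X m = (SUP n \<in> {n. cube_embeds X m n}. enat n)"


section \<open>Covering uniformities and their Hausdorff completion\<close>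

definition cover_of :: "'a set \<Rightarrow> 'a set set \<Rightarrow> bool" where
  "cover_of X \<C> \<longleftrightarrow> \<Union>\<C> = X"

definition cover_refines :: "'a set set \<Rightarrow> 'a set set \<Rightarrow> bool" where
  "cover_refines \<V> \<U> \<longleftrightarrow> (\<forall>V\<in>\<V>. \<exists>U\<in>\<U>. V \<subseteq> U)"

text \<open>The intersection with \<open>X\<close> makes the common refinement of the empty family \<open>{X}\<close>.\<close>

definition cover_common_refinement :: "'a set \<Rightarrow> 'a set set set \<Rightarrow> 'a set set" where
  "cover_common_refinement X \<F> = {X \<inter> (\<Inter>\<U>\<in>\<F>. s \<U>) | s. \<forall>\<U>\<in>\<F>. s \<U> \<in> \<U>}"

definition cover_star :: "'a \<Rightarrow> 'a set set \<Rightarrow> 'a set" where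
  "cover_star x \<U> = \<Union>{U \<in> \<U>. x \<in> U}"

definition uniform_topology :: "'a set \<Rightarrow> 'a set set set \<Rightarrow> 'a topology" where
  "uniform_topology X \<UU> =
     topology (\<lambda>G. G \<subseteq> X \<and> (\<forall>x\<in>G. \<exists>\<U>\<in>\<UU>. cover_star x \<U> \<subseteq> G))"

lemma cover_star_mono:
  assumes "cover_refines \<W> \<U>"
  shows "cover_star x \<W> \<subseteq> cover_star x \<U>"
  using assms unfolding cover_star_def cover_refines_def by blast

lemma openin_uniform_topology:
  assumes "\<And>\<U> \<V>. \<U> \<in> \<UU> \<Longrightarrow> \<V> \<in> \<UU> \<Longrightarrow>
             \<exists>\<W>\<in>\<UU>. cover_refines \<W> \<U> \<and> cover_refines \<W> \<V>"
  shows "openin (uniform_topology X \<UU>) G \<longleftrightarrow>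
           G \<subseteq> X \<and> (\<forall>x\<in>G. \<exists>\<U>\<in>\<UU>. cover_star x \<U> \<subseteq> G)"
proof -
  have int: "\<exists>\<W>\<in>\<UU>. cover_star x \<W> \<subseteq> S \<inter> T"
    if "\<exists>\<U>\<in>\<UU>. cover_star x \<U> \<subseteq> S" "\<exists>\<U>\<in>\<UU>. cover_star x \<U> \<subseteq> T" for x S T
  proof -
    obtain \<U> \<V> where "\<U> \<in> \<UU>" "\<V> \<in> \<UU>" "cover_star x \<U> \<subseteq> S" "cover_star x \<V> \<subseteq> T"
      using \<open>\<exists>\<U>\<in>\<UU>. cover_star x \<U> \<subseteq> S\<close> \<open>\<exists>\<U>\<in>\<UU>. cover_star x \<U> \<subseteq> T\<close> by blast
    moreover then obtain \<W> where "\<W> \<in> \<UU>" "cover_refines \<W> \<U>" "cover_refines \<W> \<V>"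
      using assms by blast
    ultimately show ?thesis
      using cover_star_mono[of \<W> \<U> x] cover_star_mono[of \<W> \<V> x] by blast
  qed
  have uni: "\<exists>\<U>\<in>\<UU>. cover_star x \<U> \<subseteq> \<Union>\<K>"
    if "S \<in> \<K>" "\<exists>\<U>\<in>\<UU>. cover_star x \<U> \<subseteq> S" for x S \<K>
    using that by (meson Union_upper subset_trans)
  have "istopology (\<lambda>G. G \<subseteq> X \<and> (\<forall>x\<in>G. \<exists>\<U>\<in>\<UU>. cover_star x \<U> \<subseteq> G))"
    unfolding istopology_def
  proof (intro conjI allI impI ballI)
    fix S T x
    assume "S \<subseteq> X \<and> (\<forall>x\<in>S. \<exists>\<U>\<in>\<UU>. cover_star x \<U> \<subseteq> S)"
      and "T \<subseteq> X \<and> (\<forall>x\<in>T. \<exists>\<U>\<in>\<UU>. cover_star x \<U> \<subseteq> T)"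
    then show "S \<inter> T \<subseteq> X" and "x \<in> S \<inter> T \<Longrightarrow> \<exists>\<U>\<in>\<UU>. cover_star x \<U> \<subseteq> S \<inter> T"
      using int by auto
  next
    fix \<K> x
    assume *: "\<forall>K\<in>\<K>. K \<subseteq> X \<and> (\<forall>x\<in>K. \<exists>\<U>\<in>\<UU>. cover_star x \<U> \<subseteq> K)"
    then show "\<Union>\<K> \<subseteq> X" by blast
    assume "x \<in> \<Union>\<K>"
    then obtain S where "S \<in> \<K>" "x \<in> S" by blast
    with * show "\<exists>\<U>\<in>\<UU>. cover_star x \<U> \<subseteq> \<Union>\<K>"
      using uni by metis
  qed
  then show ?thesis
    unfolding uniform_topology_def by (simp add: topology_inverse')
qed

definition cauchy_filter :: "'a set \<Rightarrow> 'a set set set \<Rightarrow> 'a filter \<Rightarrow> bool" where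
  "cauchy_filter X \<UU> F \<longleftrightarrow>
     F \<noteq> bot \<and> F \<le> principal X \<and> (\<forall>\<U>\<in>\<UU>. \<exists>U\<in>\<U>. eventually (\<lambda>x. x \<in> U) F)"

text \<open>
  Following Bourbaki, the points of the Hausdorff completion are the Cauchy filters that are
  minimal with respect to inclusion of families of sets. The order \<open>\<le>\<close> on \<^typ>\<open>'a filter\<close> is the
  reverse of this inclusion.
\<close>

definition completion_points :: "'a set \<Rightarrow> 'a set set set \<Rightarrow> 'a filter set" where
  "completion_points X \<UU> =
     {F. cauchy_filter X \<UU> F \<and> (\<forall>G. cauchy_filter X \<UU> G \<and> F \<le> G \<longrightarrow> G = F)}"

definition extended_cover :: "'a set \<Rightarrow> 'a set set set \<Rightarrow> 'a set set \<Rightarrow> 'a filter set set" where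
  "extended_cover X \<UU> \<U> =
     (\<lambda>U. {F \<in> completion_points X \<UU>. eventually (\<lambda>x. x \<in> U) F}) ` \<U>"

definition completion_uniformity :: "'a set \<Rightarrow> 'a set set set \<Rightarrow> 'a filter set set set" where
  "completion_uniformity X \<UU> =
     {\<W>. cover_of (completion_points X \<UU>) \<W> \<and>
          (\<exists>\<U>\<in>\<UU>. cover_refines (extended_cover X \<UU> \<U>) \<W>)}"

definition completion_topology :: "'a set \<Rightarrow> 'a set set set \<Rightarrow> 'a filter topology" where
  "completion_topology X \<UU> =
     uniform_topology (completion_points X \<UU>) (completion_uniformity X \<UU>)"

text \<open>The canonical map sends a point to its neighbourhood filter, a minimal Cauchy filter.\<close>

definition completion_map :: "'a set \<Rightarrow> 'a set set set \<Rightarrow> 'a \<Rightarrow> 'a filter" where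
  "completion_map X \<UU> x = nhdsin (uniform_topology X \<UU>) x"


section \<open>The median uniformity and the MMC\<close>

definition median_subbase ::
    "'a set \<Rightarrow> ('a \<Rightarrow> 'a \<Rightarrow> 'a \<Rightarrow> 'a) \<Rightarrow> 'a set set set" where
  "median_subbase X m =
     {{median_branch X m u v, median_branch X m v u} | u v.
        u \<in> X \<and> v \<in> X \<and> u \<noteq> v \<and> median_chain X m (median_interval X m u v)}"

definition median_uniformity ::
    "'a set \<Rightarrow> ('a \<Rightarrow> 'a \<Rightarrow> 'a \<Rightarrow> 'a) \<Rightarrow> 'a set set set" where
  "median_uniformity X m =
     {\<C>. cover_of X \<C> \<and>
          (\<exists>\<F>. finite \<F> \<and> \<F> \<subseteq> median_subbase X m \<and> cover_refines (cover_common_refinement X \<F>) \<C>)}"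

definition median_topology ::
    "'a set \<Rightarrow> ('a \<Rightarrow> 'a \<Rightarrow> 'a \<Rightarrow> 'a) \<Rightarrow> 'a topology" where
  "median_topology X m = uniform_topology X (median_uniformity X m)"

lemma cover_of_median_subbase:
  assumes "median_algebra X m" "\<U> \<in> median_subbase X m"
  shows "cover_of X \<U>"
proof -
  obtain u v where uv: "\<U> = {median_branch X m u v, median_branch X m v u}"
      "u \<in> X" "v \<in> X" "u \<noteq> v"
    using assms(2) unfolding median_subbase_def by blast
  have "m u x v = m v x u" if "x \<in> X" for x
    using assms(1) uv that unfolding median_algebra_def by metis
  then show ?thesis
    using uv unfolding cover_of_def median_branch_def by auto
qed

lemma cover_of_common_refinement:
  assumes "\<And>\<U>. \<U> \<in> \<F> \<Longrightarrow> cover_of X \<U>"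
  shows "cover_of X (cover_common_refinement X \<F>)"
proof -
  have "\<exists>A\<in>cover_common_refinement X \<F>. x \<in> A" if "x \<in> X" for x
  proof -
    have "\<forall>\<U>\<in>\<F>. \<exists>U\<in>\<U>. x \<in> U"
      using assms that unfolding cover_of_def by blast
    then obtain s where "\<forall>\<U>\<in>\<F>. s \<U> \<in> \<U> \<and> x \<in> s \<U>" by metis
    then have "X \<inter> (\<Inter>\<U>\<in>\<F>. s \<U>) \<in> cover_common_refinement X \<F>" "x \<in> X \<inter> (\<Inter>\<U>\<in>\<F>. s \<U>)"
      using that unfolding cover_common_refinement_def by auto
    then show ?thesis by (rule bexI[rotated])
  qed
  moreover have "A \<subseteq> X" if "A \<in> cover_common_refinement X \<F>" for A
    using that unfolding cover_common_refinement_def by auto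
  ultimately show ?thesis
    unfolding cover_of_def by (intro equalityI subsetI) (metis UnionE subsetD, metis UnionI)
qed

lemma common_refinement_antimono:
  assumes "\<F> \<subseteq> \<G>"
  shows "cover_refines (cover_common_refinement X \<G>) (cover_common_refinement X \<F>)"
  unfolding cover_refines_def
proof
  fix V assume "V \<in> cover_common_refinement X \<G>"
  then obtain s where s: "V = X \<inter> (\<Inter>\<U>\<in>\<G>. s \<U>)" "\<forall>\<U>\<in>\<G>. s \<U> \<in> \<U>"
    unfolding cover_common_refinement_def by auto
  have "X \<inter> (\<Inter>\<U>\<in>\<F>. s \<U>) \<in> cover_common_refinement X \<F>"
    unfolding cover_common_refinement_def mem_Collect_eq
    by (rule exI[of _ s]) (use s(2) assms in auto)
  moreover have "V \<subseteq> X \<inter> (\<Inter>\<U>\<in>\<F>. s \<U>)"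
    using assms s(1) by auto
  ultimately show "\<exists>U\<in>cover_common_refinement X \<F>. V \<subseteq> U" by (rule bexI[rotated])
qed

lemma cover_refines_trans:
  "cover_refines \<U> \<V> \<Longrightarrow> cover_refines \<V> \<W> \<Longrightarrow> cover_refines \<U> \<W>"
  unfolding cover_refines_def by (meson subset_trans)

lemma median_uniformity_directed:
  assumes "median_algebra X m" "\<U> \<in> median_uniformity X m" "\<V> \<in> median_uniformity X m"
  shows "\<exists>\<W>\<in>median_uniformity X m. cover_refines \<W> \<U> \<and> cover_refines \<W> \<V>"
proof -
  obtain \<F> \<G> where *: "finite \<F>" "\<F> \<subseteq> median_subbase X m" "cover_refines (cover_common_refinement X \<F>) \<U>"
      "finite \<G>" "\<G> \<subseteq> median_subbase X m" "cover_refines (cover_common_refinement X \<G>) \<V>"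
    using assms(2,3) unfolding median_uniformity_def by blast
  let ?W = "cover_common_refinement X (\<F> \<union> \<G>)"
  have "cover_of X ?W"
    using * cover_of_median_subbase[OF assms(1)] by (intro cover_of_common_refinement) blast
  moreover have "cover_refines ?W ?W"
    unfolding cover_refines_def by blast
  ultimately have "?W \<in> median_uniformity X m"
    using * unfolding median_uniformity_def by blast
  moreover have "cover_refines ?W \<U>" "cover_refines ?W \<V>"
    using * common_refinement_antimono[of \<F> "\<F> \<union> \<G>" X] common_refinement_antimono[of \<G> "\<F> \<union> \<G>" X]
      cover_refines_trans by blast+
  ultimately show ?thesis by blast
qed

lemma openin_median_topology:
  assumes "median_algebra X m"
  shows "openin (median_topology X m) G \<longleftrightarrow>
           G \<subseteq> X \<and> (\<forall>x\<in>G. \<exists>\<U>\<in>median_uniformity X m. cover_star x \<U> \<subseteq> G)"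
  unfolding median_topology_def
  using median_uniformity_directed[OF assms] by (rule openin_uniform_topology)

definition mmc_topology ::
    "'a set \<Rightarrow> ('a \<Rightarrow> 'a \<Rightarrow> 'a \<Rightarrow> 'a) \<Rightarrow> 'a filter topology" where
  "mmc_topology X m = completion_topology X (median_uniformity X m)"

definition mmc_map :: "'a set \<Rightarrow> ('a \<Rightarrow> 'a \<Rightarrow> 'a \<Rightarrow> 'a) \<Rightarrow> 'a \<Rightarrow> 'a filter" where
  "mmc_map X m = completion_map X (median_uniformity X m)"

text \<open>
  The continuous extension of \<open>m\<close> is unique only on the points of the completion, hence
  \<open>SOME\<close>, not \<open>THE\<close>; values outside the completion are irrelevant below.
\<close>

definition mmc_median ::
    "'a set \<Rightarrow> ('a \<Rightarrow> 'a \<Rightarrow> 'a \<Rightarrow> 'a) \<Rightarrow>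
     'a filter \<Rightarrow> 'a filter \<Rightarrow> 'a filter \<Rightarrow> 'a filter" where
  "mmc_median X m =
     (SOME n. continuous_map
          (prod_topology (mmc_topology X m) (prod_topology (mmc_topology X m) (mmc_topology X m)))
          (mmc_topology X m) (\<lambda>(a, b, c). n a b c) \<and>
        (\<forall>x\<in>X. \<forall>y\<in>X. \<forall>z\<in>X.
           n (mmc_map X m x) (mmc_map X m y) (mmc_map X m z) = mmc_map X m (m x y z)))"


section \<open>Median compactifications\<close>

definition topological_median_algebra ::
    "'a topology \<Rightarrow> ('a \<Rightarrow> 'a \<Rightarrow> 'a \<Rightarrow> 'a) \<Rightarrow> bool" where
  "topological_median_algebra \<sigma> m \<longleftrightarrow>
     Hausdorff_space \<sigma> \<and> median_algebra (topspace \<sigma>) m \<and>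
     continuous_map (prod_topology \<sigma> (prod_topology \<sigma> \<sigma>)) \<sigma> (\<lambda>(a, b, c). m a b c)"

definition median_preserving ::
    "'a set \<Rightarrow> ('a \<Rightarrow> 'a \<Rightarrow> 'a \<Rightarrow> 'a) \<Rightarrow> ('b \<Rightarrow> 'b \<Rightarrow> 'b \<Rightarrow> 'b) \<Rightarrow> ('a \<Rightarrow> 'b) \<Rightarrow> bool" where
  "median_preserving X m n f \<longleftrightarrow>
     (\<forall>x\<in>X. \<forall>y\<in>X. \<forall>z\<in>X. f (m x y z) = n (f x) (f y) (f z))"

definition median_compactification ::
    "'a topology \<Rightarrow> ('a \<Rightarrow> 'a \<Rightarrow> 'a \<Rightarrow> 'a) \<Rightarrow>
     'k topology \<Rightarrow> ('k \<Rightarrow> 'k \<Rightarrow> 'k \<Rightarrow> 'k) \<Rightarrow> ('a \<Rightarrow> 'k) \<Rightarrow> bool" where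
  "median_compactification \<sigma> m K mK \<eta> \<longleftrightarrow>
     topological_median_algebra K mK \<and> compact_space K \<and>
     continuous_map \<sigma> K \<eta> \<and> median_preserving (topspace \<sigma>) m mK \<eta> \<and>
     K closure_of (\<eta> ` topspace \<sigma>) = topspace K"

definition proper_median_compactification ::
    "'a topology \<Rightarrow> ('a \<Rightarrow> 'a \<Rightarrow> 'a \<Rightarrow> 'a) \<Rightarrow>
     'k topology \<Rightarrow> ('k \<Rightarrow> 'k \<Rightarrow> 'k \<Rightarrow> 'k) \<Rightarrow> ('a \<Rightarrow> 'k) \<Rightarrow> bool" where
  "proper_median_compactification \<sigma> m K mK \<eta> \<longleftrightarrow>
     median_compactification \<sigma> m K mK \<eta> \<and> embedding_map \<sigma> K \<eta>"

definition isomorphic_compactifications ::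
    "'a set \<Rightarrow> 'k topology \<Rightarrow> ('k \<Rightarrow> 'k \<Rightarrow> 'k \<Rightarrow> 'k) \<Rightarrow> ('a \<Rightarrow> 'k) \<Rightarrow>
     'l topology \<Rightarrow> ('l \<Rightarrow> 'l \<Rightarrow> 'l \<Rightarrow> 'l) \<Rightarrow> ('a \<Rightarrow> 'l) \<Rightarrow> bool" where
  "isomorphic_compactifications X K mK \<eta> L mL \<theta> \<longleftrightarrow>
     (\<exists>h. homeomorphic_map K L h \<and> median_preserving (topspace K) mK mL h \<and>
          (\<forall>x\<in>X. h (\<eta> x) = \<theta> x))"

text \<open>
  The space \<open>K\<close> ranges over topologies on the type \<^typ>\<open>'a filter\<close>. This loses no generality: if
  \<open>\<eta>\<close> has dense image in a Hausdorff space \<open>K\<close>, then mapping \<open>k\<close> to the trace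
  on \<open>X\<close> of its neighbourhood filter is injective, so \<open>K\<close> can be transported to
  \<^typ>\<open>'a filter\<close>.
\<close>

definition admits_proper_median_compactification ::
    "'a topology \<Rightarrow> ('a \<Rightarrow> 'a \<Rightarrow> 'a \<Rightarrow> 'a) \<Rightarrow> bool" where
  "admits_proper_median_compactification \<sigma> m \<longleftrightarrow>
     (\<exists>(K :: 'a filter topology) mK \<eta>. proper_median_compactification \<sigma> m K mK \<eta>)"

end

theory Submission
  imports Defs
begin

text \<open>
  Let \<open>\<eta>\<close> be an injective, continuous, median-preserving map of \<open>X\<close> onto a dense subset of a compact
  median algebra \<open>K\<close>. For a chain interval of \<open>X\<close> with ends \<open>u\<close> and \<open>v\<close>, the two open sets of all
  \<open>k\<close> whose median with \<open>\<eta> u\<close> and \<open>\<eta> v\<close> is different from \<open>\<eta> v\<close>, or from \<open>\<eta> u\<close>, cover \<open>K\<close> and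
  leave on \<open>X\<close> the subbasic cover by two branches. So the median uniformity is always coarser than the
  uniformity that \<open>X\<close> inherits from \<open>K\<close>. The two are equal as soon as any two points of \<open>K\<close>
  are separated by the retraction onto a chain interval of \<open>X\<close>, a condition called \<open>chain_separated\<close>
  below: compactness reduces the control of a neighbourhood in \<open>K\<close> to finitely many such chains
  (\<open>refinement_controls_neighbourhood\<close>). Then the traces on \<open>X\<close> of the neighbourhood filters of
  \<open>K\<close> are exactly the minimal Cauchy filters of the median uniformity, which identifies \<open>K\<close> with the
  MMC (\<open>homeomorphic_trace\<close>, \<open>isomorphic_to_mmc\<close>), and \<open>\<eta>\<close> is an embedding iff the topology of \<open>X\<close> is
  the median topology (\<open>embedding_iff_median_topology\<close>).

  It remains to see why \<open>chain_separated\<close> holds. As the intervals of \<open>X\<close> are compact, the image of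
  \<open>X\<close> is convex in \<open>K\<close> (\<open>image_convex\<close>). If points of \<open>K\<close> are separated by chains of \<open>K\<close>, a
  parallel copy of part of such a chain is found between two points of \<open>X\<close>
  (\<open>chain_separated_if_T2m\<close>). If \<open>X\<close> has finite rank, two points of \<open>K\<close> are first
  projected to distinct points \<open>p\<close> and \<open>q\<close> of \<open>X\<close> (\<open>chain_separated_if_finite_rank\<close>), and a chain is
  found between these: an interval without chain subintervals contains a square, whose sides
  again contain squares, and multiplying them yields cubes of every dimension
  (\<open>cubes_in_chainless_interval\<close>).

  Conversely, if the topology of \<open>X\<close> is the median topology, then being Hausdorff it gives enough
  chain intervals to map \<open>X\<close> injectively into their product. The factors are compact, and the closure
  of \<open>X\<close> in the product satisfies \<open>chain_separated\<close> (\<open>separated_chain_map\<close>).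
\<close>

section \<open>Betweenness and retractions in median algebras\<close>

locale median_alg =
  fixes X :: "'a set" and m :: "'a \<Rightarrow> 'a \<Rightarrow> 'a \<Rightarrow> 'a"
  assumes ma: "median_algebra X m"
begin

lemma closed [intro, simp]: "a \<in> X \<Longrightarrow> b \<in> X \<Longrightarrow> c \<in> X \<Longrightarrow> m a b c \<in> X"
  using ma unfolding median_algebra_def by blast

lemma swap12: "a \<in> X \<Longrightarrow> b \<in> X \<Longrightarrow> c \<in> X \<Longrightarrow> m a b c = m b a c"
  using ma unfolding median_algebra_def by blast

lemma swap23: "a \<in> X \<Longrightarrow> b \<in> X \<Longrightarrow> c \<in> X \<Longrightarrow> m a b c = m a c b"
  using ma unfolding median_algebra_def by blast

lemma swap13: "a \<in> X \<Longrightarrow> b \<in> X \<Longrightarrow> c \<in> X \<Longrightarrow> m a b c = m c b a"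
  by (metis swap12 swap23)

lemma majority [simp]:
  assumes "a \<in> X" "b \<in> X"
  shows "m a b b = b" "m b a b = b" "m b b a = b"
proof -
  show 1: "m a b b = b" using ma assms unfolding median_algebra_def by blast
  show "m b a b = b" using 1 swap12[OF assms(2,1,2)] by simp
  show "m b b a = b" using 1 swap13[OF assms(2,2,1)] by simp
qed

lemma assoc:
  "a \<in> X \<Longrightarrow> b \<in> X \<Longrightarrow> c \<in> X \<Longrightarrow> x \<in> X \<Longrightarrow> m (m a x b) x c = m a x (m b x c)"
  using ma unfolding median_algebra_def by blast

definition btw :: "'a \<Rightarrow> 'a \<Rightarrow> 'a \<Rightarrow> bool" where
  "btw a z b \<longleftrightarrow> m a z b = z"

lemma btw_sym: "a \<in> X \<Longrightarrow> b \<in> X \<Longrightarrow> z \<in> X \<Longrightarrow> btw a z b \<longleftrightarrow> btw b z a"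
  unfolding btw_def using swap13 by metis

lemma mem_interval: "x \<in> X \<Longrightarrow> y \<in> X \<Longrightarrow> z \<in> median_interval X m x y \<longleftrightarrow> z \<in> X \<and> btw x z y"
  unfolding median_interval_def btw_def using swap23 by (metis (mono_tags, lifting) mem_Collect_eq)

lemma btw_ends [simp]: "a \<in> X \<Longrightarrow> b \<in> X \<Longrightarrow> btw a a b" "a \<in> X \<Longrightarrow> b \<in> X \<Longrightarrow> btw a b b"
  unfolding btw_def by simp_all

text \<open>
  For a fixed \<open>a\<close> the operation \<open>\<lambda>x y. m x a y\<close> is a semilattice, associativity being the last
  axiom. Its order is \<open>\<lambda>z w. btw a z w\<close>, read as "\<open>z\<close> lies below \<open>w\<close> seen from \<open>a\<close>". The next
  facts say that this is a partial order, how it changes with the base point, and that \<open>m a b c\<close> is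
  the meet of \<open>b\<close> and \<open>c\<close>.
\<close>

lemma btw_trans:
  assumes "a \<in> X" "z \<in> X" "c \<in> X" "b \<in> X" "btw a z c" "btw a c b"
  shows "btw a z b"
proof -
  have "m z a b = m (m z a c) a b"
    using assms swap13 unfolding btw_def by (metis swap12)
  also have "\<dots> = m z a (m c a b)" using assms assoc by simp
  also have "\<dots> = m z a c" using assms swap12 unfolding btw_def by metis
  finally show ?thesis using assms swap12 unfolding btw_def by metis
qed

lemma btw_shift:
  assumes "a \<in> X" "z \<in> X" "c \<in> X" "b \<in> X" "btw a z c" "btw a c b"
  shows "btw z c b"
proof -
  have "m z c b = m (m z c a) c b"
    using assms swap12 swap23 unfolding btw_def by metis
  also have "\<dots> = m z c (m a c b)" using assms assoc by simp
  also have "\<dots> = c" using assms unfolding btw_def by simp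
  finally show ?thesis unfolding btw_def .
qed

lemma btw_antisym:
  "a \<in> X \<Longrightarrow> z \<in> X \<Longrightarrow> w \<in> X \<Longrightarrow> btw a z w \<Longrightarrow> btw a w z \<Longrightarrow> z = w"
  unfolding btw_def using swap23 by metis

lemma btw_meet:
  assumes "a \<in> X" "z \<in> X" "b \<in> X" "c \<in> X" "btw a z b" "btw a z c"
  shows "btw a z (m a b c)"
proof -
  have "m z a (m b a c) = m (m z a b) a c" using assms assoc by simp
  also have "\<dots> = z" using assms swap12 unfolding btw_def by metis
  finally show ?thesis using assms swap12 closed unfolding btw_def by metis
qed

lemma median_btw:
  assumes "a \<in> X" "b \<in> X" "c \<in> X"
  shows "btw a (m a b c) b" "btw a (m a b c) c" "btw b (m a b c) c"
proof -
  have *: "btw a (m a b c) b" if "a \<in> X" "b \<in> X" "c \<in> X" for a b c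
  proof -
    have "m a b (m a b c) = m (m a b a) b c" using that assoc[of a a c b] by simp
    also have "\<dots> = m a b c" using that by simp
    finally show ?thesis using that swap23 closed unfolding btw_def by metis
  qed
  show "btw a (m a b c) b" using * assms by blast
  show "btw a (m a b c) c" using *[of a c b] assms swap23 by metis
  show "btw b (m a b c) c" using *[of b c a] assms swap12 swap23 by metis
qed

text \<open>
  A point \<open>z\<close> in all three intervals lies below the median seen from \<open>a\<close>; a change of base point
  turns this into the reverse comparison seen from \<open>b\<close>. This uniqueness is the tool that replaces
  equational computations below: two medians agree once the betweenness relations do.
\<close>

lemma median_unique:
  assumes X: "a \<in> X" "b \<in> X" "c \<in> X" "z \<in> X"
    and "btw a z b" "btw b z c" "btw a z c"
  shows "z = m a b c"
proof (rule btw_antisym[of b])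
  let ?M = "m a b c"
  have 1: "btw a z ?M" using assms btw_meet by blast
  have "btw z ?M b" by (rule btw_shift[of a]) (use X 1 median_btw in auto)
  then show "btw b ?M z" using X btw_sym by auto
  have "btw b z (m b a c)" by (rule btw_meet) (use assms btw_sym in auto)
  then show "btw b z ?M" using X swap12 by metis
qed (use X in auto)

text \<open>
  The nearest point \<open>m a z b\<close> of the interval is passed on the way from \<open>z\<close> to any other point \<open>c\<close>
  of it. The meet \<open>w\<close> of \<open>a\<close>, \<open>b\<close> and \<open>c\<close> seen from \<open>z\<close> lies on the path
  \<open>a, p, w, q, b\<close>, where \<open>p\<close> and \<open>q\<close> are the medians with \<open>c\<close>; hence it lies between \<open>a\<close> and \<open>b\<close>
  and is the median of \<open>z\<close>, \<open>a\<close> and \<open>b\<close>.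
\<close>

lemma gate:
  assumes X: "a \<in> X" "b \<in> X" "c \<in> X" "z \<in> X" and c: "btw a c b"
  shows "btw z (m a z b) c"
proof -
  define p q where "p = m z a c" and "q = m z b c"
  define w where "w = m z p q"
  have [simp]: "p \<in> X" "q \<in> X" "w \<in> X" using X by (auto simp: p_def q_def w_def)
  have p: "btw z p a" "btw z p c" "btw a p c" and q: "btw z q b" "btw z q c" "btw b q c"
    using X median_btw[of z a c] median_btw[of z b c] by (auto simp: p_def q_def)
  have w: "btw z w p" "btw z w q" "btw p w q"
    using X median_btw[of z p q] by (auto simp: w_def)
  have wz: "btw z w a" "btw z w b" "btw z w c"
    using btw_trans[of z w p a] btw_trans[of z w q b] btw_trans[of z w p c] X p q w by auto
  have cq: "btw a c q" using btw_shift[of b q c a] X q c btw_sym by auto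
  have pq: "btw a p q" using btw_trans[of a p c q] X p cq by auto
  have qb: "btw a q b" using btw_trans[of b q c a] X q c btw_sym by auto
  have "btw a w q" using btw_trans[of q w p a] X w pq btw_sym by auto
  then have "btw a w b" using btw_trans[of a w q b] X qb by auto
  then have "w = m z a b" by (intro median_unique) (use X wz in auto)
  then show ?thesis using wz X swap12 by metis
qed

text \<open>
  The gate \<open>g\<close> of \<open>e\<close> lies on the way from \<open>e\<close> to \<open>c\<close> and on the way from \<open>e\<close> to \<open>d\<close>. As \<open>e\<close> is
  itself between \<open>c\<close> and \<open>d\<close>, these ways have only \<open>e\<close> in common.
\<close>

lemma interval_convex:
  assumes X: "a \<in> X" "b \<in> X" "c \<in> X" "d \<in> X" "e \<in> X"
    and "btw a c b" "btw a d b" "btw c e d"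
  shows "btw a e b"
proof -
  define g where "g = m a e b"
  have [simp]: "g \<in> X" using X by (simp add: g_def)
  have g: "btw e g c" "btw e g d" using gate[of a b c e] gate[of a b d e] assms by (auto simp: g_def)
  have "btw g e d" using btw_shift[of c g e d] X g assms btw_sym by auto
  then have "g = e" using btw_antisym[of d g e] X g btw_sym by auto
  then show ?thesis by (simp add: g_def btw_def)
qed

text \<open>
  If \<open>e\<close> is the median of the three images, then \<open>e\<close> lies below both \<open>x\<close> and \<open>y\<close> seen from the
  image of \<open>z\<close>, hence below \<open>z\<close>. But the image of \<open>z\<close> is the gate of \<open>z\<close>, so it is equal to \<open>e\<close>.
\<close>

lemma retraction_btw:
  assumes X: "a \<in> X" "b \<in> X" "x \<in> X" "y \<in> X" "z \<in> X" and z: "btw x z y"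
  shows "btw (m a x b) (m a z b) (m a y b)"
proof -
  define x' y' z' where "x' = m a x b" and "y' = m a y b" and "z' = m a z b"
  define e where "e = m z' x' y'"
  have [simp]: "x' \<in> X" "y' \<in> X" "z' \<in> X" "e \<in> X" using X by (auto simp: x'_def y'_def z'_def e_def)
  have i: "btw a x' b" "btw a y' b" "btw a z' b"
    using X median_btw by (auto simp: x'_def y'_def z'_def)
  have e: "btw z' e x'" "btw z' e y'" "btw x' e y'" using median_btw[of z' x' y'] by (auto simp: e_def)
  have ie: "btw a e b" by (rule interval_convex[of _ _ x' y']) (use X i e in auto)
  have "btw x x' z'" "btw y y' z'" using gate[of a b z'] X i by (auto simp: x'_def y'_def)
  then have "btw z' e x" "btw z' e y"
    using btw_trans[of z' e x' x] btw_trans[of z' e y' y] X e btw_sym by auto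
  then have 1: "btw z' e (m z' x y)" using btw_meet X by auto
  have "btw z' (m x z' y) z" by (rule gate) (use X z in auto)
  then have "btw z' e z" using btw_trans[of z' e "m z' x y" z] 1 X swap12[of x z' y] by auto
  moreover have "btw z z' e" using gate[of a b e z] X ie by (simp add: z'_def)
  ultimately have "e = z'" using btw_antisym[of z e z'] X btw_sym by auto
  then show ?thesis using e unfolding x'_def y'_def z'_def by simp
qed

lemma retraction_hom:
  assumes "a \<in> X" "b \<in> X" "x \<in> X" "y \<in> X" "z \<in> X"
  shows "m a (m x y z) b = m (m a x b) (m a y b) (m a z b)"
  by (rule median_unique) (use assms median_btw[of x y z] in \<open>auto intro!: retraction_btw\<close>)

text \<open>
  Nested retractions compose: the retraction onto a subinterval factors through the larger interval.
\<close>

lemma retraction_absorb: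
  assumes X: "a \<in> X" "b \<in> X" "c \<in> X" "d \<in> X" "z \<in> X" and "btw a c b" "btw a d b"
  shows "m c (m a z b) d = m c z d"
proof -
  let ?g = "m a z b" let ?h = "m c ?g d"
  have g: "btw z ?g c" "btw z ?g d" using gate[of a b c z] gate[of a b d z] assms by auto
  have h: "btw c ?h ?g" "btw c ?h d" "btw ?g ?h d" using median_btw[of c ?g d] X by auto
  show ?thesis
  proof (rule median_unique)
    show "btw c ?h z" using btw_trans[of c ?h ?g z] h g X btw_sym by auto
    show "btw z ?h d" using btw_trans[of d ?h ?g z] h g X btw_sym by auto
  qed (use X h in auto)
qed

text \<open>
  A first-order description of chain intervals: no linear order has to be produced or chosen, as the
  order seen from one end serves.
\<close>

definition chain_between :: "'a \<Rightarrow> 'a \<Rightarrow> bool" where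
  "chain_between u v \<longleftrightarrow> (\<forall>z\<in>X. \<forall>w\<in>X. btw u z v \<longrightarrow> btw u w v \<longrightarrow> btw u z w \<or> btw u w z)"

text \<open>
  A linear order \<open>r\<close> that witnesses a chain need not have \<open>u\<close> as its least element; but the middle
  one of \<open>u\<close>, \<open>z\<close>, \<open>w\<close> can only be \<open>u\<close> if \<open>u\<close> is equal to \<open>z\<close> or \<open>w\<close>, because both lie between \<open>u\<close> and \<open>v\<close>.
\<close>

lemma median_chain_iff_chain_between:
  assumes X: "u \<in> X" "v \<in> X"
  shows "median_chain X m (median_interval X m u v) \<longleftrightarrow> chain_between u v" (is "median_chain X m ?I \<longleftrightarrow> _")
proof
  have uI: "u \<in> ?I" "v \<in> ?I" using X by (auto simp: mem_interval)
  assume "median_chain X m ?I"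
  then obtain r where r: "linear_order_on ?I r"
      "\<And>a b c. a \<in> ?I \<Longrightarrow> b \<in> ?I \<Longrightarrow> c \<in> ?I \<Longrightarrow> (a,b) \<in> r \<Longrightarrow> (b,c) \<in> r \<Longrightarrow> btw a b c"
    unfolding median_chain_def btw_def by blast
  have tot: "(a,b) \<in> r \<or> (b,a) \<in> r" if "a \<in> ?I" "b \<in> ?I" for a b
    using r(1) that unfolding linear_order_on_def partial_order_on_def preorder_on_def
      total_on_def refl_on_def by (cases "a = b") auto
  have main: "btw u z w \<or> btw u w z"
    if zw: "z \<in> ?I" "w \<in> ?I" "(z,w) \<in> r" for z w
  proof -
    have zX: "z \<in> X" "btw u z v" "w \<in> X" "btw u w v" using zw X by (auto simp: mem_interval)
    consider "(u,z) \<in> r" | "(w,u) \<in> r" | "(z,u) \<in> r" "(u,w) \<in> r"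
      using tot uI zw by blast
    then show ?thesis
    proof cases
      case 1 then show ?thesis using r(2) zw uI by blast
    next
      case 2 then have "btw z w u" using r(2) zw uI by blast
      then show ?thesis using btw_sym zX X by blast
    next
      case 3
      consider "(u,v) \<in> r" | "(v,u) \<in> r" using tot uI by blast
      then show ?thesis
      proof cases
        case 1
        then have "btw z u v" using r(2) 3 zw uI by blast
        then have "z = u" using zX X btw_antisym[of v z u] btw_sym by blast
        then show ?thesis using X zX by simp
      next
        case 2
        then have "btw v u w" using r(2) 3 zw uI by blast
        then have "w = u" using zX X btw_antisym[of v w u] btw_sym by blast
        then show ?thesis using X zX by simp
      qed
    qed
  qed
  show "chain_between u v" unfolding chain_between_def
  proof (intro ballI impI)
    fix z w assume "z \<in> X" "w \<in> X" "btw u z v" "btw u w v"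
    then have "z \<in> ?I" "w \<in> ?I" using X by (auto simp: mem_interval)
    then show "btw u z w \<or> btw u w z" using tot[of z w] main[of z w] main[of w z] by blast
  qed
next
  assume chain_between: "chain_between u v"
  define r where "r = {(z,w). z \<in> ?I \<and> w \<in> ?I \<and> btw u z w}"
  have I: "z \<in> ?I \<longleftrightarrow> z \<in> X \<and> btw u z v" for z using X mem_interval by blast
  have "median_subalgebra X m ?I"
    unfolding median_subalgebra_def
  proof (intro conjI ballI)
    fix a b c assume "a \<in> ?I" "b \<in> ?I" "c \<in> ?I"
    then show "m a b c \<in> ?I" using interval_convex[of u v a b "m a b c"] X median_btw[of a b c] I by auto
  qed (auto simp: I)
  moreover have "linear_order_on ?I r"
    unfolding linear_order_on_def partial_order_on_def preorder_on_def
  proof (intro conjI)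
    show "r \<subseteq> ?I \<times> ?I" by (auto simp: r_def)
    show "refl_on ?I r" using X by (auto simp: refl_on_def r_def I)
    show "trans r" unfolding trans_def r_def using X I btw_trans[of u] by blast
    show "antisym r" unfolding antisym_def r_def using X I btw_antisym[of u] by blast
    show "total_on ?I r" using chain_between unfolding total_on_def r_def chain_between_def by (auto simp: I)
  qed
  moreover have "m a b c = b" if "(a,b) \<in> r" "(b,c) \<in> r" for a b c
    using btw_shift[of u a b c] that X I unfolding r_def btw_def by auto
  ultimately show "median_chain X m ?I" unfolding median_chain_def by blast
qed

lemma chain_between_sym:
  assumes X: "u \<in> X" "v \<in> X" and "chain_between u v"
  shows "chain_between v u"
  unfolding chain_between_def
proof (intro ballI impI)
  fix z w assume zw: "z \<in> X" "w \<in> X" "btw v z u" "btw v w u"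
  have s: "btw v b a" if "btw u a b" "btw v b u" "a \<in> X" "b \<in> X" for a b
    using btw_shift[of u a b v] that X btw_sym by blast
  from zw have "btw u z w \<or> btw u w z" using assms btw_sym unfolding chain_between_def by blast
  then show "btw v z w \<or> btw v w z" using s zw by blast
qed

lemma chain_between_subinterval:
  assumes X: "u \<in> X" "v \<in> X" "a \<in> X" "b \<in> X" and uv: "chain_between u v" and "btw u a v" "btw u b v"
  shows "chain_between a b"
proof -
  have *: "chain_between a b" if ab: "a \<in> X" "b \<in> X" "btw u a v" "btw u b v" "btw u a b" for a b
    unfolding chain_between_def
  proof (intro ballI impI)
    fix z w assume zw: "z \<in> X" "w \<in> X" "btw a z b" "btw a w b"
    have v: "btw u y v" if "y \<in> X" "btw a y b" for y
      using interval_convex[of u v a b y] X ab that by blast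
    have a: "btw u a y" if "y \<in> X" "btw a y b" for y
      using btw_shift[of b y a u] X ab that btw_sym by blast
    have "btw u z w \<or> btw u w z" using zw uv v unfolding chain_between_def by blast
    then show "btw a z w \<or> btw a w z"
    proof
      assume "btw u z w"
      then show ?thesis using btw_shift[of u a z w] a[of z] zw X ab by simp
    next
      assume "btw u w z"
      then show ?thesis using btw_shift[of u a w z] a[of w] zw X ab by simp
    qed
  qed
  have "btw u a b \<or> btw u b a" using assms unfolding chain_between_def by blast
  then show ?thesis using *[of a b] *[of b a] chain_between_sym assms by blast
qed

end

section \<open>Intervals without chains contain cubes\<close>

context median_alg
begin

text \<open>
  The interval is a distributive lattice with least element \<open>p\<close>. Two incomparable elements \<open>z\<close> and
  \<open>w\<close> span a square with bottom \<open>c\<close> and top \<open>d\<close>, and the interval from \<open>c\<close> to \<open>d\<close> is the product of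
  its sides. By induction the side from \<open>c\<close> to \<open>z\<close> contains a cube of dimension \<open>n\<close>; the other side
  contributes the edge from \<open>c\<close> to \<open>w\<close>.
\<close>

lemma cubes_in_chainless_interval:
  assumes "p \<in> X" "q \<in> X" "p \<noteq> q"
    and "\<And>a b. a \<in> X \<Longrightarrow> b \<in> X \<Longrightarrow> btw p a q \<Longrightarrow> btw p b q \<Longrightarrow> chain_between a b \<Longrightarrow> a = b"
  shows "\<exists>f. inj_on f (cube n) \<and> (\<forall>\<xi>\<in>cube n. f \<xi> \<in> X \<and> btw p (f \<xi>) q) \<and>
           (\<forall>\<xi>\<in>cube n. \<forall>\<upsilon>\<in>cube n. \<forall>\<zeta>\<in>cube n.
              f (cube_median n \<xi> \<upsilon> \<zeta>) = m (f \<xi>) (f \<upsilon>) (f \<zeta>))"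
  using assms
proof (induction n arbitrary: p q)
  case 0
  then show ?case by (intro exI[of _ "\<lambda>_. p"]) (auto simp: cube_def)
next
  case (Suc n)
  note X[simp] = Suc.prems(1,2)
  have "\<not> chain_between p q" using Suc.prems by force
  then obtain z w where zw: "z \<in> X" "w \<in> X" "btw p z q" "btw p w q" "\<not> btw p z w" "\<not> btw p w z"
    unfolding chain_between_def by blast
  define c d where "c = m p z w" and "d = m q z w"
  have [simp]: "z \<in> X" "w \<in> X" "c \<in> X" "d \<in> X" using zw by (auto simp: c_def d_def)
  have c: "btw p c z" "btw p c w" "btw z c w" using median_btw[of p z w] by (auto simp: c_def)
  have d: "btw q d z" "btw q d w" "btw z d w" using median_btw[of q z w] by (auto simp: d_def)
  have ne: "c \<noteq> z" "c \<noteq> w" using c zw by auto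
  have pd: "btw p d q" using interval_convex[of p q z w d] zw d by simp
  have zd: "btw p z d" using btw_shift[of q d z p] d zw btw_sym by simp
  have wd: "btw p w d" using btw_shift[of q d w p] d zw btw_sym by simp
  have cq: "btw p c q" using interval_convex[of p q z w c] zw c by simp
  have "\<exists>f. inj_on f (cube n) \<and> (\<forall>\<xi>\<in>cube n. f \<xi> \<in> X \<and> btw c (f \<xi>) z) \<and>
           (\<forall>\<xi>\<in>cube n. \<forall>\<upsilon>\<in>cube n. \<forall>\<zeta>\<in>cube n.
              f (cube_median n \<xi> \<upsilon> \<zeta>) = m (f \<xi>) (f \<upsilon>) (f \<zeta>))"
  proof (rule Suc.IH)
    fix a b assume "a \<in> X" "b \<in> X" "btw c a z" "btw c b z" "chain_between a b"
    then show "a = b"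
      using Suc.prems(4)[of a b] interval_convex[of p q c z] cq zw by auto
  qed (use ne in auto)
  then obtain f where f: "inj_on f (cube n)" "\<And>\<xi>. \<xi> \<in> cube n \<Longrightarrow> f \<xi> \<in> X"
      "\<And>\<xi>. \<xi> \<in> cube n \<Longrightarrow> btw c (f \<xi>) z"
      "\<And>\<xi> \<upsilon> \<zeta>. \<xi> \<in> cube n \<Longrightarrow> \<upsilon> \<in> cube n \<Longrightarrow> \<zeta> \<in> cube n \<Longrightarrow>
         f (cube_median n \<xi> \<upsilon> \<zeta>) = m (f \<xi>) (f \<upsilon>) (f \<zeta>)"
    by blast
  define \<rho> where "\<rho> \<xi> = restrict \<xi> {..<n}" for \<xi> :: "nat \<Rightarrow> bool"
  \<comment> \<open>The last coordinate decides whether the join with \<open>w\<close> is taken; inside the square this join is a median with \<open>d\<close>.\<close>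
  define g where "g \<xi> = (if \<xi> n then m d (f (\<rho> \<xi>)) w else f (\<rho> \<xi>))" for \<xi>
  have \<rho>[simp]: "\<rho> \<xi> \<in> cube n" for \<xi> by (auto simp: \<rho>_def cube_def)
  have fX[simp]: "f (\<rho> \<xi>) \<in> X" "g \<xi> \<in> X" for \<xi> using f(2) by (auto simp: g_def)
  have fz: "btw p (f (\<rho> \<xi>)) z" for \<xi>
    using interval_convex[of p z c z "f (\<rho> \<xi>)"] c f(3) by simp
  have fd: "btw p (f (\<rho> \<xi>)) d" for \<xi> using btw_trans[of p _ z d] fz zd by simp
  have gd: "btw p (g \<xi>) d" for \<xi>
    unfolding g_def using fd interval_convex[of p d "f (\<rho> \<xi>)" w] wd median_btw[of d "f (\<rho> \<xi>)" w] by simp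
  have mz: "m p (f (\<rho> \<xi>)) z = f (\<rho> \<xi>)" for \<xi> using fz btw_def by simp
  have mw: "m p (f (\<rho> \<xi>)) w = c" for \<xi>
  proof -
    have "m p (f (\<rho> \<xi>)) w = m p (m p (f (\<rho> \<xi>)) z) w" by (simp only: mz)
    also have "\<dots> = m (m p p w) (m p (f (\<rho> \<xi>)) w) (m p z w)" by (rule retraction_hom) simp_all
    also have "\<dots> = m p (m p (f (\<rho> \<xi>)) w) c" by (simp add: c_def)
    also have "\<dots> = m p c (m p (f (\<rho> \<xi>)) w)" by (simp add: swap23)
    also have "\<dots> = c"
    proof -
      have "btw p c (f (\<rho> \<xi>))" using btw_shift[of z "f (\<rho> \<xi>)" c p] f(3) c btw_sym by simp
      then have "btw p c (m p (f (\<rho> \<xi>)) w)" using c btw_meet by simp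
      then show ?thesis by (simp add: btw_def)
    qed
    finally show ?thesis .
  qed
  have gz: "m p (g \<xi>) z = f (\<rho> \<xi>)" for \<xi>
  proof (cases "\<xi> n")
    case True
    have "m p (g \<xi>) z = m (m p d z) (m p (f (\<rho> \<xi>)) z) (m p w z)"
      using True retraction_hom[of p z d "f (\<rho> \<xi>)" w] by (simp add: g_def)
    also have "\<dots> = m z (f (\<rho> \<xi>)) c" using zd by (simp add: mz btw_def c_def swap23)
    also have "\<dots> = f (\<rho> \<xi>)" using f(3)[of "\<rho> \<xi>"] btw_sym by (simp add: btw_def)
    finally show ?thesis .
  qed (simp add: g_def mz)
  have gw: "m p (g \<xi>) w = (if \<xi> n then w else c)" for \<xi>
  proof (cases "\<xi> n")
    case True
    have "m p (g \<xi>) w = m (m p d w) (m p (f (\<rho> \<xi>)) w) (m p w w)"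
      using True retraction_hom[of p w d "f (\<rho> \<xi>)" w] by (simp add: g_def)
    also have "\<dots> = w" using wd by (simp add: btw_def swap23)
    finally show ?thesis using True by simp
  qed (simp add: g_def mw)
  \<comment> \<open>A point below \<open>d\<close> is the join of its meets with \<open>z\<close> and \<open>w\<close>.\<close>
  have det: "t = m q (m p t z) (m p t w)" if [simp]: "t \<in> X" and t: "btw p t d" for t
  proof -
    have tq: "btw p t q" using btw_trans[of p t d q] t pd by simp
    have "t = m p d t" using t by (simp add: btw_def swap23)
    also have "\<dots> = m (m p q t) (m p z t) (m p w t)"
      unfolding d_def by (rule retraction_hom) simp_all
    also have "m p q t = t" using tq by (simp add: btw_def swap23)
    finally have e: "t = m t (m p z t) (m p w t)" .
    let ?a = "m p t z" let ?b = "m p t w"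
    have e': "btw ?a t ?b" using e by (simp add: btw_def swap23 swap12)
    have a: "btw p ?a t" "btw p ?b t" using median_btw[of p t] by simp_all
    show ?thesis
    proof (rule median_unique)
      show "btw q t ?a" using btw_shift[of p ?a t q] a tq btw_sym by simp
      show "btw q t ?b" using btw_shift[of p ?b t q] a tq btw_sym by simp
    qed (use e' in auto)
  qed
  have ext: "t = t'" if "t \<in> X" "t' \<in> X" "btw p t d" "btw p t' d"
    "m p t z = m p t' z" "m p t w = m p t' w" for t t'
    using det[of t] det[of t'] that by simp
  have \<rho>_med: "\<rho> (cube_median (Suc n) \<xi> \<upsilon> \<zeta>) = cube_median n (\<rho> \<xi>) (\<rho> \<upsilon>) (\<rho> \<zeta>)" for \<xi> \<upsilon> \<zeta>
    by (auto simp: \<rho>_def cube_median_def restrict_def fun_eq_iff)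
  show ?case
  proof (intro exI[of _ g] conjI ballI)
    show "inj_on g (cube (Suc n))"
    proof (rule inj_onI)
      fix \<xi> \<upsilon> assume \<xi>: "\<xi> \<in> cube (Suc n)" "\<upsilon> \<in> cube (Suc n)" and e: "g \<xi> = g \<upsilon>"
      have "f (\<rho> \<xi>) = f (\<rho> \<upsilon>)" using gz e by metis
      then have 1: "\<rho> \<xi> = \<rho> \<upsilon>" using f(1) \<rho> by (meson inj_onD)
      have 2: "\<xi> n = \<upsilon> n" using gw[of \<xi>] gw[of \<upsilon>] e ne by (metis (full_types))
      show "\<xi> = \<upsilon>"
      proof
        fix i
        consider "i < n" | "i = n" | "i > n" by linarith
        then show "\<xi> i = \<upsilon> i"
        proof cases
          case 1 then show ?thesis using \<open>\<rho> \<xi> = \<rho> \<upsilon>\<close> unfolding \<rho>_def by (metis lessThan_iff restrict_apply')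
        next
          case 3 then show ?thesis using \<xi> unfolding cube_def by (auto simp: PiE_def extensional_def)
        qed (simp add: 2)
      qed
    qed
  next
    fix \<xi> assume "\<xi> \<in> cube (Suc n)"
    show "g \<xi> \<in> X" "btw p (g \<xi>) q" using btw_trans[of p "g \<xi>" d q] gd pd by simp_all
  next
    fix \<xi> \<upsilon> \<zeta> assume "\<xi> \<in> cube (Suc n)" "\<upsilon> \<in> cube (Suc n)" "\<zeta> \<in> cube (Suc n)"
    let ?\<mu> = "cube_median (Suc n) \<xi> \<upsilon> \<zeta>" let ?t = "m (g \<xi>) (g \<upsilon>) (g \<zeta>)"
    show "g ?\<mu> = ?t"
    proof (rule ext)
      show "btw p ?t d" using interval_convex[of p d "g \<xi>" "g \<upsilon>" ?t] gd median_btw[of "g \<xi>" "g \<upsilon>" "g \<zeta>"] by simp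
      show "m p (g ?\<mu>) z = m p ?t z"
        by (simp add: gz retraction_hom[of p z "g \<xi>" "g \<upsilon>" "g \<zeta>"] \<rho>_med f(4))
      have \<mu>: "?\<mu> n = bool_median (\<xi> n) (\<upsilon> n) (\<zeta> n)" by (simp add: cube_median_def)
      show "m p (g ?\<mu>) w = m p ?t w"
        by (auto simp: gw retraction_hom[of p w "g \<xi>" "g \<upsilon>" "g \<zeta>"] \<mu> bool_median_def)
    qed (use gd in auto)
  qed
qed

text \<open>
  A bound on the dimension of cubes provides a chain somewhere in the interval; it is cut down until
  it runs in the direction from \<open>p\<close> to \<open>q\<close>, so that its retraction sends \<open>p\<close> and \<open>q\<close> to its ends.
\<close>

lemma exists_separating_chain:
  assumes rank: "median_rank X m \<noteq> \<infinity>" and X: "p \<in> X" "q \<in> X" "p \<noteq> q"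
  obtains a b where "a \<in> X" "b \<in> X" "a \<noteq> b" "btw p a q" "btw p b q" "chain_between a b"
    "m a p b = a" "m a q b = b"
proof -
  have "\<exists>a b. a \<in> X \<and> b \<in> X \<and> btw p a q \<and> btw p b q \<and> chain_between a b \<and> a \<noteq> b"
  proof (rule ccontr)
    assume *: "\<not> ?thesis"
    have "cube_embeds X m n" for n
      using cubes_in_chainless_interval[OF X, of n] * unfolding cube_embeds_def by blast
    moreover obtain k where "median_rank X m = enat k" using rank by auto
    moreover have "enat n \<le> median_rank X m" if "cube_embeds X m n" for n
      unfolding median_rank_def using that by (intro SUP_upper) simp
    ultimately have "enat (Suc k) \<le> enat k" by metis
    then show False by simp
  qed
  then obtain a b where ab: "a \<in> X" "b \<in> X" "btw p a q" "btw p b q" "chain_between a b" "a \<noteq> b" by blast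
  \<comment> \<open>The chain need not be oriented from \<open>p\<close> to \<open>q\<close>; the part from the meet of its ends to one of them is.\<close>
  define c where "c = m p a b"
  have c: "c \<in> X" "btw p c a" "btw p c b" "btw a c b"
    using ab X median_btw[of p a b] by (auto simp: c_def)
  note result = that
  have main: thesis if e: "e \<in> X" "btw p e q" "btw p c e" "c \<noteq> e" "btw a e b" for e
  proof (rule result[of c e])
    show "btw p c q" using btw_trans[of p c e q] X c e by blast
    show "chain_between c e" using chain_between_subinterval[of a b c e] ab c e by blast
    show "m c p e = c" using e X c swap12 unfolding btw_def by metis
    have "btw c e q" using btw_shift[of p c e q] X c e by blast
    then show "m c q e = e" using e X c swap23 unfolding btw_def by metis
  qed (use c e in auto)
  show thesis using main[of a] main[of b] ab c btw_ends by metis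
qed

end

section \<open>Dense maps into compact median algebras\<close>

lemma continuous_map_median:
  assumes "topological_median_algebra \<sigma> m"
    and "continuous_map S \<sigma> f" "continuous_map S \<sigma> g" "continuous_map S \<sigma> h"
  shows "continuous_map S \<sigma> (\<lambda>s. m (f s) (g s) (h s))"
proof -
  have "continuous_map S (prod_topology \<sigma> (prod_topology \<sigma> \<sigma>)) (\<lambda>s. (f s, g s, h s))"
    using assms by (simp add: continuous_map_pairwise o_def)
  moreover have "continuous_map (prod_topology \<sigma> (prod_topology \<sigma> \<sigma>)) \<sigma> (\<lambda>(a,b,c). m a b c)"
    using assms(1) unfolding topological_median_algebra_def by blast
  ultimately have "continuous_map S \<sigma> ((\<lambda>(a,b,c). m a b c) \<circ> (\<lambda>s. (f s, g s, h s)))"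
    by (rule continuous_map_compose)
  then show ?thesis by (simp add: o_def)
qed

locale dense_median_map =
  fixes \<sigma> :: "'a topology" and m :: "'a \<Rightarrow> 'a \<Rightarrow> 'a \<Rightarrow> 'a"
    and K :: "'k topology" and n :: "'k \<Rightarrow> 'k \<Rightarrow> 'k \<Rightarrow> 'k" and \<eta> :: "'a \<Rightarrow> 'k"
  assumes source: "topological_median_algebra \<sigma> m"
    and target: "topological_median_algebra K n"
    and compact: "compact_space K"
    and continuous: "continuous_map \<sigma> K \<eta>"
    and preserving: "median_preserving (topspace \<sigma>) m n \<eta>"
    and dense: "K closure_of (\<eta> ` topspace \<sigma>) = topspace K"
    and inj: "inj_on \<eta> (topspace \<sigma>)"
begin

sublocale M: median_alg "topspace \<sigma>" m
  using source unfolding topological_median_algebra_def by unfold_locales blast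

sublocale N: median_alg "topspace K" n
  using target unfolding topological_median_algebra_def by unfold_locales blast

abbreviation X :: "'a set" where "X \<equiv> topspace \<sigma>"

lemma Hausdorff: "Hausdorff_space K"
  using target unfolding topological_median_algebra_def by blast

lemma eta_in [simp]: "x \<in> X \<Longrightarrow> \<eta> x \<in> topspace K"
  using continuous by (auto simp: continuous_map_def)

lemma eta_median: "x \<in> X \<Longrightarrow> y \<in> X \<Longrightarrow> z \<in> X \<Longrightarrow> \<eta> (m x y z) = n (\<eta> x) (\<eta> y) (\<eta> z)"
  using preserving unfolding median_preserving_def by blast

lemma eta_eq_iff: "x \<in> X \<Longrightarrow> y \<in> X \<Longrightarrow> \<eta> x = \<eta> y \<longleftrightarrow> x = y"
  using inj by (auto dest: inj_onD)

lemma btw_eta: "x \<in> X \<Longrightarrow> y \<in> X \<Longrightarrow> z \<in> X \<Longrightarrow> N.btw (\<eta> x) (\<eta> y) (\<eta> z) \<longleftrightarrow> M.btw x y z"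
  unfolding N.btw_def M.btw_def by (metis M.closed eta_median eta_eq_iff)

lemmas continuous_median = continuous_map_median[OF target]

lemma continuous_retraction:
  assumes "u \<in> topspace K" "v \<in> topspace K"
  shows "continuous_map K K (\<lambda>k. n u k v)"
  by (rule continuous_median) (use assms in auto)

lemma openin_retraction_neq:
  assumes "u \<in> topspace K" "v \<in> topspace K" "w \<in> topspace K"
  shows "openin K {k \<in> topspace K. n u k v \<noteq> w}"
proof -
  have "openin K (topspace K - {w})"
    using closedin_t1_singleton[OF Hausdorff_imp_t1_space[OF Hausdorff] assms(3)]
    by (simp add: closedin_def)
  then have "openin K {k \<in> topspace K. n u k v \<in> topspace K - {w}}"
    by (rule openin_continuous_map_preimage[OF continuous_retraction[OF assms(1,2)]])
  moreover have "{k \<in> topspace K. n u k v \<in> topspace K - {w}} = {k \<in> topspace K. n u k v \<noteq> w}"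
    using assms by auto
  ultimately show ?thesis by simp
qed

lemma dense_meets:
  assumes "openin K W" "k \<in> W"
  obtains x where "x \<in> X" "\<eta> x \<in> W"
proof -
  have "k \<in> K closure_of (\<eta> ` X)" using assms openin_subset unfolding dense by blast
  then show thesis using assms that unfolding in_closure_of by auto
qed

text \<open>
  These filters on \<open>X\<close> are going to be the points of the completion.
\<close>

definition nbhd_trace :: "'k \<Rightarrow> 'a filter" where
  "nbhd_trace k = inf (filtercomap \<eta> (nhdsin K k)) (principal X)"

lemma eventually_trace:
  assumes "k \<in> topspace K"
  shows "eventually P (nbhd_trace k) \<longleftrightarrow>
           (\<exists>W. openin K W \<and> k \<in> W \<and> (\<forall>x\<in>X. \<eta> x \<in> W \<longrightarrow> P x))" (is "?L \<longleftrightarrow> ?R")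
proof
  assume ?L
  then show ?R using assms
    unfolding nbhd_trace_def eventually_inf_principal eventually_filtercomap eventually_nhdsin by blast
next
  assume ?R
  then obtain W where W: "openin K W" "k \<in> W" "\<forall>x\<in>X. \<eta> x \<in> W \<longrightarrow> P x" by blast
  then show ?L
    unfolding nbhd_trace_def eventually_inf_principal eventually_filtercomap eventually_nhdsin
    by (intro exI[of _ "\<lambda>k. k \<in> W"]) blast
qed

lemma trace_not_bot: "k \<in> topspace K \<Longrightarrow> nbhd_trace k \<noteq> bot"
  unfolding trivial_limit_def using eventually_trace[of k "\<lambda>_. False"] dense_meets by blast

text \<open>
  The median uniformity is coarser than the uniformity inherited from \<open>K\<close>: the retraction onto an
  interval with ends in \<open>X\<close> extends to \<open>K\<close>, and the two open sets on which its value differs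
  from one of the ends cover \<open>K\<close> and leave the two branches as traces on \<open>X\<close>.
\<close>

lemma subbase_member_near:
  assumes "\<U> \<in> median_subbase X m" "k \<in> topspace K"
  obtains U W where "U \<in> \<U>" "openin K W" "k \<in> W" "\<And>x. x \<in> X \<Longrightarrow> \<eta> x \<in> W \<Longrightarrow> x \<in> U"
proof -
  obtain u v where uv: "\<U> = {median_branch X m u v, median_branch X m v u}" "u \<in> X" "v \<in> X" "u \<noteq> v"
    using assms(1) unfolding median_subbase_def by blast
  note result = that
  have *: thesis
    if uv: "u \<in> X" "v \<in> X" "median_branch X m u v \<in> \<U>" "n (\<eta> u) k (\<eta> v) \<noteq> \<eta> v" for u v
  proof (rule result[OF uv(3) openin_retraction_neq[of "\<eta> u" "\<eta> v" "\<eta> v"]])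
    fix x assume "x \<in> X" "\<eta> x \<in> {k \<in> topspace K. n (\<eta> u) k (\<eta> v) \<noteq> \<eta> v}"
    then show "x \<in> median_branch X m u v"
      unfolding median_branch_def using uv eta_median[of u x v] by auto
  qed (use uv assms in auto)
  have "n (\<eta> v) k (\<eta> u) = n (\<eta> u) k (\<eta> v)" using N.swap13 uv assms(2) by simp
  moreover have "\<eta> u \<noteq> \<eta> v" using eta_eq_iff uv by blast
  ultimately show thesis using *[of u v] *[of v u] uv by (metis insertI1 insertI2)
qed

lemma refinement_member_near:
  assumes "finite \<F>" "\<F> \<subseteq> median_subbase X m" "k \<in> topspace K"
  obtains A W where "A \<in> cover_common_refinement X \<F>" "openin K W" "k \<in> W"
    "\<And>x. x \<in> X \<Longrightarrow> \<eta> x \<in> W \<Longrightarrow> x \<in> A"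
proof -
  have "\<forall>\<U>\<in>\<F>. \<exists>U W. U \<in> \<U> \<and> openin K W \<and> k \<in> W \<and> (\<forall>x\<in>X. \<eta> x \<in> W \<longrightarrow> x \<in> U)"
  proof
    fix \<U> assume "\<U> \<in> \<F>"
    then have "\<U> \<in> median_subbase X m" using assms(2) by blast
    then show "\<exists>U W. U \<in> \<U> \<and> openin K W \<and> k \<in> W \<and> (\<forall>x\<in>X. \<eta> x \<in> W \<longrightarrow> x \<in> U)"
      using subbase_member_near[OF _ assms(3)] by (metis (no_types, lifting))
  qed
  then obtain s W where sW: "\<And>\<U>. \<U> \<in> \<F> \<Longrightarrow> s \<U> \<in> \<U> \<and> openin K (W \<U>) \<and> k \<in> W \<U> \<and>
      (\<forall>x\<in>X. \<eta> x \<in> W \<U> \<longrightarrow> x \<in> s \<U>)" by metis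
  show thesis
  proof (rule that)
    show "X \<inter> (\<Inter>\<U>\<in>\<F>. s \<U>) \<in> cover_common_refinement X \<F>"
      unfolding cover_common_refinement_def using sW by blast
    show "openin K (topspace K \<inter> (\<Inter>\<U>\<in>\<F>. W \<U>))"
      using assms(1)
    proof (cases "\<F> = {}")
      case False
      then have "openin K (\<Inter>\<U>\<in>\<F>. W \<U>)" using sW assms(1) by (intro openin_Inter) auto
      then show ?thesis by blast
    qed simp
  qed (use sW assms in auto)
qed

lemma cauchy_trace:
  assumes "k \<in> topspace K"
  shows "cauchy_filter X (median_uniformity X m) (nbhd_trace k)"
  unfolding cauchy_filter_def
proof (intro conjI ballI)
  show "nbhd_trace k \<noteq> bot" using assms by (rule trace_not_bot)
  show "nbhd_trace k \<le> principal X" unfolding nbhd_trace_def by simp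
  fix \<U> assume "\<U> \<in> median_uniformity X m"
  then obtain \<F> where \<F>: "finite \<F>" "\<F> \<subseteq> median_subbase X m"
      "cover_refines (cover_common_refinement X \<F>) \<U>"
    unfolding median_uniformity_def by blast
  obtain A W where AW: "A \<in> cover_common_refinement X \<F>" "openin K W" "k \<in> W"
      "\<And>x. x \<in> X \<Longrightarrow> \<eta> x \<in> W \<Longrightarrow> x \<in> A"
    using refinement_member_near[OF \<F>(1,2) assms] by blast
  then obtain U where "U \<in> \<U>" "A \<subseteq> U" using \<F>(3) unfolding cover_refines_def by blast
  then show "\<exists>U\<in>\<U>. eventually (\<lambda>x. x \<in> U) (nbhd_trace k)"
    using AW eventually_trace[OF assms] by blast
qed

lemma refinement_in_uniformity:
  assumes "finite \<F>" "\<F> \<subseteq> median_subbase X m"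
  shows "cover_common_refinement X \<F> \<in> median_uniformity X m"
proof -
  have "cover_of X (cover_common_refinement X \<F>)"
    using assms cover_of_median_subbase[OF M.ma] by (intro cover_of_common_refinement) blast
  then show ?thesis using assms unfolding median_uniformity_def cover_refines_def by blast
qed

lemma subbase_pair:
  "a \<in> X \<Longrightarrow> b \<in> X \<Longrightarrow> a \<noteq> b \<Longrightarrow> M.chain_between a b \<Longrightarrow>
     {median_branch X m a b, median_branch X m b a} \<in> median_subbase X m"
  unfolding median_subbase_def using M.median_chain_iff_chain_between by blast

lemma cauchy_cluster_point:
  assumes "G \<noteq> bot" "G \<le> principal X"
  obtains k where "k \<in> topspace K" "\<And>W. openin K W \<Longrightarrow> k \<in> W \<Longrightarrow> frequently (\<lambda>x. \<eta> x \<in> W) G"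
proof (rule ccontr)
  assume "\<not> thesis"
  then have "\<forall>k\<in>topspace K. \<exists>W. openin K W \<and> k \<in> W \<and> eventually (\<lambda>x. \<eta> x \<notin> W) G"
    using that unfolding frequently_def by blast
  then obtain W where W: "\<And>k. k \<in> topspace K \<Longrightarrow> openin K (W k) \<and> k \<in> W k \<and> eventually (\<lambda>x. \<eta> x \<notin> W k) G"
    by metis
  have "\<exists>\<F>. finite \<F> \<and> \<F> \<subseteq> W ` topspace K \<and> topspace K \<subseteq> \<Union>\<F>"
    using compact W unfolding compact_space_alt by (elim allE[of _ "W ` topspace K"]) blast
  then obtain T where T: "finite T" "T \<subseteq> topspace K" "topspace K \<subseteq> \<Union>(W ` T)"
    by (metis finite_subset_image)
  have "eventually (\<lambda>x. \<forall>k\<in>T. \<eta> x \<notin> W k) G"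
    using T W by (intro eventually_ball_finite) auto
  moreover have "eventually (\<lambda>x. x \<in> X) G" using assms(2) by (simp add: le_principal)
  ultimately have "eventually (\<lambda>_. False) G"
    by eventually_elim (use T eta_in in blast)
  then show False using assms(1) by (simp add: trivial_limit_def)
qed

end

section \<open>Separation by chains determines the uniformity\<close>

text \<open>
  The chains that separate points of \<open>K\<close> are required to be intervals of \<open>X\<close>: only these occur in
  the median uniformity of \<open>X\<close>.
\<close>

definition chain_separated ::
    "'a set \<Rightarrow> ('a \<Rightarrow> 'a \<Rightarrow> 'a \<Rightarrow> 'a) \<Rightarrow> 'k set \<Rightarrow> ('k \<Rightarrow> 'k \<Rightarrow> 'k \<Rightarrow> 'k) \<Rightarrow> ('a \<Rightarrow> 'k) \<Rightarrow> bool" where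
  "chain_separated X m Y n \<eta> \<longleftrightarrow>
     (\<forall>k\<in>Y. \<forall>l\<in>Y. k \<noteq> l \<longrightarrow> (\<exists>a\<in>X. \<exists>b\<in>X. a \<noteq> b \<and>
        median_chain X m (median_interval X m a b) \<and>
        n (\<eta> a) k (\<eta> b) = \<eta> a \<and> n (\<eta> a) l (\<eta> b) = \<eta> b))"

locale separated_median_map = dense_median_map +
  assumes separated: "chain_separated (topspace \<sigma>) m (topspace K) n \<eta>"
begin

text \<open>
  For a compactness argument the retraction has to take the values \<open>a\<close> and \<open>b\<close> near \<open>k\<close> and
  near \<open>l\<close>, and not just at these points. For this the chain is made shorter. Either some
  subchain that starts at \<open>a\<close> has only two points, and then the values of the retraction on \<open>X\<close> are
  isolated from each other. Or there are two inner points \<open>w\<close> and \<open>w'\<close>, and the retraction onto the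
  part between them is constant on the open set of points that project below \<open>w\<close>, and on the
  open set of points that project above \<open>w'\<close>.
\<close>

lemma separating_branches:
  assumes "k \<in> topspace K" "l \<in> topspace K" "k \<noteq> l"
  shows "\<exists>a\<in>X. \<exists>b\<in>X. a \<noteq> b \<and> M.chain_between a b \<and> (\<exists>U V. openin K U \<and> openin K V \<and> k \<in> U \<and> l \<in> V \<and>
     (\<forall>x\<in>X. \<eta> x \<in> U \<longrightarrow> m a x b = a) \<and> (\<forall>x\<in>X. \<eta> x \<in> V \<longrightarrow> m a x b = b))"
proof -
  obtain a b where ab: "a \<in> X" "b \<in> X" "a \<noteq> b" "M.chain_between a b"
      "n (\<eta> a) k (\<eta> b) = \<eta> a" "n (\<eta> a) l (\<eta> b) = \<eta> b"
  proof -
    have "\<exists>a\<in>X. \<exists>b\<in>X. a \<noteq> b \<and> median_chain X m (median_interval X m a b) \<and>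
        n (\<eta> a) k (\<eta> b) = \<eta> a \<and> n (\<eta> a) l (\<eta> b) = \<eta> b"
      using separated assms unfolding chain_separated_def by simp
    then show thesis using M.median_chain_iff_chain_between that by auto
  qed
  \<comment> \<open>If no point lies strictly between \<open>a\<close> and \<open>d\<close>, these two are the only values on \<open>X\<close>.\<close>
  have jump: ?thesis
    if d: "d \<in> X" "M.btw a d b" "a \<noteq> d" and no: "\<And>w. w \<in> X \<Longrightarrow> M.btw a w d \<Longrightarrow> w = a \<or> w = d" for d
  proof (intro bexI exI conjI ballI impI)
    let ?U = "{k \<in> topspace K. n (\<eta> a) k (\<eta> d) \<noteq> \<eta> d}"
    let ?V = "{k \<in> topspace K. n (\<eta> a) k (\<eta> d) \<noteq> \<eta> a}"
    show "openin K ?U" "openin K ?V" using openin_retraction_neq ab d by simp_all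
    have N: "N.btw (\<eta> a) (\<eta> d) (\<eta> b)" using btw_eta ab d by simp
    have "n (\<eta> a) k (\<eta> d) = n (\<eta> a) (n (\<eta> a) k (\<eta> b)) (\<eta> d)"
      using N.retraction_absorb[of "\<eta> a" "\<eta> b" "\<eta> a" "\<eta> d" k] ab d N assms by simp
    then show "k \<in> ?U" using ab d assms eta_eq_iff by auto
    have "n (\<eta> a) l (\<eta> d) = n (\<eta> a) (n (\<eta> a) l (\<eta> b)) (\<eta> d)"
      using N.retraction_absorb[of "\<eta> a" "\<eta> b" "\<eta> a" "\<eta> d" l] ab d N assms by simp
    also have "\<dots> = \<eta> d" using N ab d N.swap23 unfolding N.btw_def by simp
    finally show "l \<in> ?V" using ab d assms eta_eq_iff by auto
    show "a \<noteq> d" "M.chain_between a d" using d M.chain_between_subinterval[of a b a d] ab by auto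
    fix x assume x: "x \<in> X"
    then have *: "m a x d = a \<or> m a x d = d" using no[of "m a x d"] M.median_btw[of a x d] ab d by simp
    have e: "\<eta> (m a x d) = n (\<eta> a) (\<eta> x) (\<eta> d)" using eta_median ab d x by simp
    show "m a x d = a" if "\<eta> x \<in> ?U" using that e * by auto
    show "m a x d = d" if "\<eta> x \<in> ?V" using that e * by auto
  qed (use ab d in auto)
  show ?thesis
  proof (cases "\<exists>w\<in>X. \<exists>w'\<in>X. M.btw a w' b \<and> w' \<noteq> b \<and> M.btw a w w' \<and> w \<noteq> a \<and> w \<noteq> w'")
    case False
    show ?thesis
    proof (cases "\<exists>w\<in>X. M.btw a w b \<and> w \<noteq> a \<and> w \<noteq> b")
      case True
      then obtain d where d: "d \<in> X" "M.btw a d b" "d \<noteq> a" "d \<noteq> b" by blast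
      show ?thesis
      proof (rule jump)
        show "w = a \<or> w = d" if "w \<in> X" "M.btw a w d" for w
          using False d that by blast
      qed (use d in auto)
    next
      case False
      then show ?thesis using jump[of b] ab by auto
    qed
  next
    case True
    then obtain w w' where w: "w \<in> X" "w' \<in> X" "M.btw a w' b" "w' \<noteq> b" "M.btw a w w'" "w \<noteq> a" "w \<noteq> w'"
      by blast
    have wb: "M.btw a w b" using M.btw_trans[of a w w' b] w ab by simp
    have N: "N.btw (\<eta> a) (\<eta> w) (\<eta> b)" "N.btw (\<eta> a) (\<eta> w') (\<eta> b)" using btw_eta ab w wb by simp_all
    let ?U = "{k \<in> topspace K. n (\<eta> a) k (\<eta> w) \<noteq> \<eta> w}"
    let ?V = "{k \<in> topspace K. n (\<eta> w') k (\<eta> b) \<noteq> \<eta> w'}"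
    show ?thesis
    proof (intro bexI exI conjI ballI impI)
      show "openin K ?U" "openin K ?V" using openin_retraction_neq ab w by simp_all
      have "n (\<eta> a) k (\<eta> w) = n (\<eta> a) (n (\<eta> a) k (\<eta> b)) (\<eta> w)"
        using N.retraction_absorb[of "\<eta> a" "\<eta> b" "\<eta> a" "\<eta> w" k] ab w N assms by simp
      then show "k \<in> ?U" using ab w assms eta_eq_iff by auto
      have "n (\<eta> w') l (\<eta> b) = n (\<eta> w') (n (\<eta> a) l (\<eta> b)) (\<eta> b)"
        using N.retraction_absorb[of "\<eta> a" "\<eta> b" "\<eta> w'" "\<eta> b" l] ab w N assms by simp
      then show "l \<in> ?V" using ab w assms eta_eq_iff by auto
      show "w \<noteq> w'" by fact
      show "M.chain_between w w'" using M.chain_between_subinterval[of a b w w'] ab w wb by simp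
      fix x assume x: "x \<in> X"
      define z where "z = m a x b"
      have z: "z \<in> X" "M.btw a z b" using M.median_btw[of a x b] ab x by (simp_all add: z_def)
      have mx: "m a z w = m a x w" "m w z w' = m w x w'" "m w' z b = m w' x b"
        using M.retraction_absorb[of a b] ab w wb x by (simp_all add: z_def)
      show "m w x w' = w" if "\<eta> x \<in> ?U"
      proof -
        have "m a z w \<noteq> w" using that eta_median[of a x w] ab w x mx by auto
        then have "\<not> M.btw a w z" using ab w z M.swap23 unfolding M.btw_def by metis
        then have "M.btw a z w" using ab w wb z unfolding M.chain_between_def by blast
        then have "M.btw z w w'" using M.btw_shift[of a z w w'] ab w z by simp
        then show ?thesis using mx w z M.swap12 unfolding M.btw_def by metis
      qed
      show "m w x w' = w'" if "\<eta> x \<in> ?V"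
      proof -
        have "m w' z b \<noteq> w'" using that eta_median[of w' x b] ab w x mx by auto
        then have "\<not> M.btw z w' b" using ab w z M.swap12 unfolding M.btw_def by metis
        then have "\<not> M.btw a z w'" using M.btw_shift[of a z w' b] ab w z by blast
        then have "M.btw a w' z" using ab w z unfolding M.chain_between_def by blast
        then have "M.btw w w' z" using M.btw_shift[of a w w' z] ab w z by simp
        then show ?thesis using mx w z M.swap23 unfolding M.btw_def by metis
      qed
    qed (use w in auto)
  qed
qed

lemma T2m_source: "T2m X m"
  unfolding T2m_def canonical_retraction_def
proof (intro ballI impI)
  fix x y assume xy: "x \<in> X" "y \<in> X" "x \<noteq> y"
  then have "\<eta> x \<noteq> \<eta> y" using eta_eq_iff by blast
  then obtain a b where ab: "a \<in> X" "b \<in> X" "a \<noteq> b" "M.chain_between a b" "m a x b = a" "m a y b = b"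
    using separating_branches[of "\<eta> x" "\<eta> y"] xy eta_in by blast
  then show "\<exists>u\<in>X. \<exists>v\<in>X. u \<noteq> v \<and> median_chain X m (median_interval X m u v) \<and> {m u x v, m u y v} = {u, v}"
    using M.median_chain_iff_chain_between[OF ab(1,2)] by (intro bexI[of _ a] bexI[of _ b]) simp_all
qed

text \<open>
  The uniformity inherited from \<open>K\<close> is coarser than the median uniformity. The complement of \<open>V\<close> is
  covered by finitely many sets \<open>P l\<close>, on the trace of which a retraction has the value \<open>b l\<close>,
  while it has the value \<open>a l\<close> on the trace of a neighbourhood of \<open>k\<close>. A member \<open>A\<close> of the common
  refinement with a point near \<open>k\<close> lies in the branches where the value \<open>b l\<close> is not taken, hence
  its image misses all \<open>P l\<close>. The closed set \<open>C\<close> makes it possible to pass to limits of \<open>A\<close>.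
\<close>

lemma refinement_controls_neighbourhood:
  assumes V: "openin K V" "k \<in> V"
  obtains \<F> W C where "finite \<F>" "\<F> \<subseteq> median_subbase X m" "openin K W" "k \<in> W" "closedin K C" "C \<subseteq> V"
    "\<And>A x. A \<in> cover_common_refinement X \<F> \<Longrightarrow> x \<in> A \<Longrightarrow> \<eta> x \<in> W \<Longrightarrow> \<eta> ` A \<subseteq> C"
proof -
  have k: "k \<in> topspace K" using V openin_subset by blast
  have "\<forall>l\<in>topspace K - V. \<exists>a b U P. a \<in> X \<and> b \<in> X \<and> a \<noteq> b \<and> M.chain_between a b \<and> openin K U \<and> openin K P \<and>
     k \<in> U \<and> l \<in> P \<and> (\<forall>x\<in>X. \<eta> x \<in> U \<longrightarrow> m a x b = a) \<and> (\<forall>x\<in>X. \<eta> x \<in> P \<longrightarrow> m a x b = b)"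
  proof
    fix l assume l: "l \<in> topspace K - V"
    then have "l \<in> topspace K" "k \<noteq> l" using V by auto
    from separating_branches[OF k this]
    show "\<exists>a b U P. a \<in> X \<and> b \<in> X \<and> a \<noteq> b \<and> M.chain_between a b \<and> openin K U \<and> openin K P \<and>
     k \<in> U \<and> l \<in> P \<and> (\<forall>x\<in>X. \<eta> x \<in> U \<longrightarrow> m a x b = a) \<and> (\<forall>x\<in>X. \<eta> x \<in> P \<longrightarrow> m a x b = b)"
      by (elim bexE conjE exE) (intro exI conjI)
  qed
  then obtain a b U P where abUP: "\<And>l. l \<in> topspace K - V \<Longrightarrow> a l \<in> X \<and> b l \<in> X \<and> a l \<noteq> b l \<and>
     M.chain_between (a l) (b l) \<and> openin K (U l) \<and> openin K (P l) \<and>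
     k \<in> U l \<and> l \<in> P l \<and> (\<forall>x\<in>X. \<eta> x \<in> U l \<longrightarrow> m (a l) x (b l) = a l) \<and>
     (\<forall>x\<in>X. \<eta> x \<in> P l \<longrightarrow> m (a l) x (b l) = b l)"
    by metis
  have "compactin K (topspace K - V)"
    using compact V by (simp add: closedin_compact_space closedin_def Diff_Diff_Int openin_subset inf.absorb2)
  then have "\<exists>\<P>. finite \<P> \<and> \<P> \<subseteq> P ` (topspace K - V) \<and> topspace K - V \<subseteq> \<Union>\<P>"
    using abUP unfolding compactin_def by (elim conjE allE[of _ "P ` (topspace K - V)"]) blast
  then obtain L where L: "finite L" "L \<subseteq> topspace K - V" "topspace K - V \<subseteq> \<Union>(P ` L)"
    by (metis finite_subset_image)
  define pair where "pair l = {median_branch X m (a l) (b l), median_branch X m (b l) (a l)}" for l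
  show thesis
  proof (rule that)
    show "finite (pair ` L)" using L by simp
    show "pair ` L \<subseteq> median_subbase X m"
    proof (rule image_subsetI)
      fix l assume "l \<in> L"
      then have "l \<in> topspace K - V" using L by blast
      from abUP[OF this] show "pair l \<in> median_subbase X m"
        unfolding pair_def by (elim conjE) (rule subbase_pair)
    qed
    show "openin K (topspace K \<inter> (\<Inter>l\<in>L. U l))"
    proof (cases "L = {}")
      case False
      then have "openin K (\<Inter>l\<in>L. U l)" using abUP L by (intro openin_Inter) auto
      then show ?thesis by blast
    qed simp
    show "k \<in> topspace K \<inter> (\<Inter>l\<in>L. U l)" using abUP L k by blast
    show "closedin K (topspace K - \<Union>(P ` L))" using abUP L by blast
    show "topspace K - \<Union>(P ` L) \<subseteq> V" using L by blast
    fix A x assume A: "A \<in> cover_common_refinement X (pair ` L)" "x \<in> A"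
      and x: "\<eta> x \<in> topspace K \<inter> (\<Inter>l\<in>L. U l)"
    obtain s where s: "A = X \<inter> (\<Inter>\<U>\<in>pair ` L. s \<U>)" "\<forall>\<U>\<in>pair ` L. s \<U> \<in> \<U>"
      using A(1) unfolding cover_common_refinement_def by blast
    show "\<eta> ` A \<subseteq> topspace K - \<Union>(P ` L)"
    proof (intro image_subsetI DiffI notI)
      fix y assume y: "y \<in> A"
      then show "\<eta> y \<in> topspace K" using s by simp
      assume "\<eta> y \<in> \<Union>(P ` L)"
      then obtain l where l: "l \<in> L" "\<eta> y \<in> P l" by blast
      have xy: "x \<in> X" "y \<in> X" "x \<in> s (pair l)" "y \<in> s (pair l)" using A y l s by blast+
      have 1: "m (a l) x (b l) = a l" using abUP x l L xy by blast
      have 2: "m (a l) y (b l) = b l" using abUP l L xy by blast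
      have lX: "a l \<in> X" "b l \<in> X" using abUP l L by blast+
      have "s (pair l) \<in> pair l" using s(2) l(1) by blast
      then consider "s (pair l) = median_branch X m (a l) (b l)" | "s (pair l) = median_branch X m (b l) (a l)"
        unfolding pair_def by blast
      then show False
      proof cases
        case 1 then show False using xy 2 unfolding median_branch_def by simp
      next
        case 2
        then show False using xy \<open>m (a l) x (b l) = a l\<close> lX M.swap13[of "b l" x "a l"]
          unfolding median_branch_def by simp
      qed
    qed
  qed
qed

text \<open>
  One direction uses that subbasic covers are traces of open covers of \<open>K\<close>, the other that a
  common refinement controls a given neighbourhood in \<open>K\<close>.
\<close>

lemma openin_median_topology_iff:
  "openin (median_topology X m) G \<longleftrightarrow>
     G \<subseteq> X \<and> (\<forall>x\<in>G. \<exists>W. openin K W \<and> \<eta> x \<in> W \<and> (\<forall>y\<in>X. \<eta> y \<in> W \<longrightarrow> y \<in> G))"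
  unfolding openin_median_topology[OF M.ma]
proof (rule conj_cong[OF refl], rule ball_cong[OF refl], rule iffI)
  fix x assume G: "G \<subseteq> X" "x \<in> G"
  then have x: "x \<in> X" "\<eta> x \<in> topspace K" by auto
  {
    assume "\<exists>\<U>\<in>median_uniformity X m. cover_star x \<U> \<subseteq> G"
    then obtain \<U> \<F> where \<F>: "cover_star x \<U> \<subseteq> G" "finite \<F>" "\<F> \<subseteq> median_subbase X m"
        "cover_refines (cover_common_refinement X \<F>) \<U>"
      unfolding median_uniformity_def by blast
    obtain A W where AW: "A \<in> cover_common_refinement X \<F>" "openin K W" "\<eta> x \<in> W"
        "\<And>y. y \<in> X \<Longrightarrow> \<eta> y \<in> W \<Longrightarrow> y \<in> A"
      using refinement_member_near[OF \<F>(2,3) x(2)] by blast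
    have "A \<subseteq> cover_star x (cover_common_refinement X \<F>)"
      using AW x unfolding cover_star_def by blast
    also have "\<dots> \<subseteq> G" using cover_star_mono[OF \<F>(4)] \<F>(1) by blast
    finally show "\<exists>W. openin K W \<and> \<eta> x \<in> W \<and> (\<forall>y\<in>X. \<eta> y \<in> W \<longrightarrow> y \<in> G)" using AW by blast
  }
  assume "\<exists>W. openin K W \<and> \<eta> x \<in> W \<and> (\<forall>y\<in>X. \<eta> y \<in> W \<longrightarrow> y \<in> G)"
  then obtain V where V: "openin K V" "\<eta> x \<in> V" "\<forall>y\<in>X. \<eta> y \<in> V \<longrightarrow> y \<in> G" by blast
  obtain \<F> W C where \<F>: "finite \<F>" "\<F> \<subseteq> median_subbase X m" "\<eta> x \<in> W" "C \<subseteq> V"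
    "\<And>A x. A \<in> cover_common_refinement X \<F> \<Longrightarrow> x \<in> A \<Longrightarrow> \<eta> x \<in> W \<Longrightarrow> \<eta> ` A \<subseteq> C"
    using refinement_controls_neighbourhood[OF V(1,2)] by metis
  have "cover_star x (cover_common_refinement X \<F>) \<subseteq> G"
  proof
    fix y assume "y \<in> cover_star x (cover_common_refinement X \<F>)"
    then obtain A where A: "A \<in> cover_common_refinement X \<F>" "x \<in> A" "y \<in> A"
      unfolding cover_star_def by blast
    have "y \<in> X" using A unfolding cover_common_refinement_def by blast
    moreover have "\<eta> y \<in> V" using \<F>(5)[OF A(1,2) \<F>(3)] \<F>(4) A(3) by blast
    ultimately show "y \<in> G" using V by blast
  qed
  then show "\<exists>\<U>\<in>median_uniformity X m. cover_star x \<U> \<subseteq> G"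
    using refinement_in_uniformity[OF \<F>(1,2)] by blast
qed

end

section \<open>Compactifications separated by chains are the MMC\<close>

lemma extended_cover_in_completion_uniformity:
  assumes "\<C> \<in> median_uniformity X m"
  shows "extended_cover X (median_uniformity X m) \<C> \<in> completion_uniformity X (median_uniformity X m)"
proof -
  have "cover_of (completion_points X (median_uniformity X m)) (extended_cover X (median_uniformity X m) \<C>)"
    using assms unfolding cover_of_def extended_cover_def completion_points_def cauchy_filter_def by auto
  then show ?thesis using assms unfolding completion_uniformity_def cover_refines_def by blast
qed

lemma completion_uniformity_directed:
  assumes "median_algebra X m"
    and "\<V> \<in> completion_uniformity X (median_uniformity X m)"
    and "\<W> \<in> completion_uniformity X (median_uniformity X m)"
  shows "\<exists>\<Z>\<in>completion_uniformity X (median_uniformity X m). cover_refines \<Z> \<V> \<and> cover_refines \<Z> \<W>"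
proof -
  let ?P = "completion_points X (median_uniformity X m)"
  let ?ext = "extended_cover X (median_uniformity X m)"
  obtain \<A> \<B> where A: "\<A> \<in> median_uniformity X m" "cover_refines (?ext \<A>) \<V>"
      and B: "\<B> \<in> median_uniformity X m" "cover_refines (?ext \<B>) \<W>"
    using assms(2,3) unfolding completion_uniformity_def by blast
  obtain \<C> where C: "\<C> \<in> median_uniformity X m" "cover_refines \<C> \<A>" "cover_refines \<C> \<B>"
    using median_uniformity_directed[OF assms(1) A(1) B(1)] by blast
  have ext: "cover_refines (?ext \<C>) (?ext \<D>)" if CD: "cover_refines \<C> \<D>" for \<D>
    unfolding cover_refines_def
  proof
    fix V assume "V \<in> ?ext \<C>"
    then obtain U where U: "U \<in> \<C>" "V = {F \<in> ?P. eventually (\<lambda>x. x \<in> U) F}"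
      unfolding extended_cover_def by blast
    then obtain D where D: "D \<in> \<D>" "U \<subseteq> D" using CD unfolding cover_refines_def by blast
    then have "V \<subseteq> {F \<in> ?P. eventually (\<lambda>x. x \<in> D) F}"
      unfolding U by (auto elim!: eventually_mono)
    then show "\<exists>E\<in>?ext \<D>. V \<subseteq> E" using D(1) unfolding extended_cover_def by blast
  qed
  have "?ext \<C> \<in> completion_uniformity X (median_uniformity X m)"
    by (rule extended_cover_in_completion_uniformity[OF C(1)])
  then show ?thesis
    using cover_refines_trans[OF ext[OF C(2)] A(2)] cover_refines_trans[OF ext[OF C(3)] B(2)] by blast
qed

lemma openin_mmc_topology:
  assumes "median_algebra X m"
  shows "openin (mmc_topology X m) G \<longleftrightarrow>
           G \<subseteq> completion_points X (median_uniformity X m) \<and>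
           (\<forall>F\<in>G. \<exists>\<W>\<in>completion_uniformity X (median_uniformity X m). cover_star F \<W> \<subseteq> G)"
  unfolding mmc_topology_def completion_topology_def
  by (rule openin_uniform_topology) (rule completion_uniformity_directed[OF assms])

lemma topspace_mmc_topology:
  assumes "median_algebra X m"
  shows "topspace (mmc_topology X m) = completion_points X (median_uniformity X m)" (is "_ = ?P")
proof
  show "topspace (mmc_topology X m) \<subseteq> ?P"
    using openin_mmc_topology[OF assms] openin_topspace by blast
  have "{X} \<in> median_uniformity X m"
    unfolding median_uniformity_def cover_of_def cover_refines_def cover_common_refinement_def
    by (auto intro!: exI[of _ "{}"])
  then have ne: "extended_cover X (median_uniformity X m) {X} \<in> completion_uniformity X (median_uniformity X m)"
    by (rule extended_cover_in_completion_uniformity)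
  have "cover_star F (extended_cover X (median_uniformity X m) {X}) \<subseteq> ?P" for F
    unfolding cover_star_def extended_cover_def by auto
  then have "openin (mmc_topology X m) ?P"
    unfolding openin_mmc_topology[OF assms] using ne by blast
  then show "?P \<subseteq> topspace (mmc_topology X m)" by (rule openin_subset)
qed

context separated_median_map
begin

text \<open>
  By compactness a Cauchy filter has a cluster point \<open>k\<close>. A small member of the filter has points
  near \<open>k\<close>, hence lies in a given neighbourhood of \<open>k\<close>: the filter converges to \<open>k\<close>.
\<close>

lemma cauchy_le_trace:
  assumes G: "cauchy_filter X (median_uniformity X m) G"
  obtains k where "k \<in> topspace K" "G \<le> nbhd_trace k"
proof -
  have "G \<noteq> bot" "G \<le> principal X" using G unfolding cauchy_filter_def by blast+
  then obtain k where k: "k \<in> topspace K" "\<And>W. openin K W \<Longrightarrow> k \<in> W \<Longrightarrow> frequently (\<lambda>x. \<eta> x \<in> W) G"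
    using cauchy_cluster_point by blast
  have "G \<le> nbhd_trace k"
  proof (rule filter_leI)
    fix P assume "eventually P (nbhd_trace k)"
    then obtain V where V: "openin K V" "k \<in> V" "\<forall>x\<in>X. \<eta> x \<in> V \<longrightarrow> P x"
      using eventually_trace[OF k(1)] by blast
    obtain \<F> W C where \<F>: "finite \<F>" "\<F> \<subseteq> median_subbase X m" "openin K W" "k \<in> W" "C \<subseteq> V"
      "\<And>A x. A \<in> cover_common_refinement X \<F> \<Longrightarrow> x \<in> A \<Longrightarrow> \<eta> x \<in> W \<Longrightarrow> \<eta> ` A \<subseteq> C"
      using refinement_controls_neighbourhood[OF V(1,2)] by metis
    obtain A where A: "A \<in> cover_common_refinement X \<F>" "eventually (\<lambda>x. x \<in> A) G"
      using refinement_in_uniformity[OF \<F>(1,2)] G unfolding cauchy_filter_def by blast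
    have "\<exists>x. x \<in> A \<and> \<eta> x \<in> W"
    proof (rule ccontr)
      assume *: "\<not> ?thesis"
      have "eventually (\<lambda>x. \<eta> x \<notin> W) G" using A(2) by (rule eventually_mono) (use * in blast)
      then show False using k(2)[OF \<F>(3,4)] unfolding frequently_def by simp
    qed
    then have "\<eta> ` A \<subseteq> V" using \<F>(5,6) A(1) by blast
    moreover have "A \<subseteq> X" using A(1) unfolding cover_common_refinement_def by blast
    ultimately have "\<And>x. x \<in> A \<Longrightarrow> P x" using V(3) by blast
    with A(2) show "eventually P G" by (rule eventually_mono)
  qed
  then show thesis using that k(1) by blast
qed

lemma trace_le_trace:
  assumes "k \<in> topspace K" "l \<in> topspace K" "nbhd_trace k \<le> nbhd_trace l"
  shows "k = l"
proof (rule ccontr)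
  assume "k \<noteq> l"
  then have "\<exists>U V. openin K U \<and> openin K V \<and> k \<in> U \<and> l \<in> V \<and> disjnt U V"
    using Hausdorff assms(1,2) unfolding Hausdorff_space_def by simp
  then obtain U V where UV: "openin K U" "openin K V" "k \<in> U" "l \<in> V" "disjnt U V"
    by (elim exE conjE)
  have "eventually (\<lambda>x. \<eta> x \<in> U) (nbhd_trace k)" using UV eventually_trace[OF assms(1)] by blast
  moreover have "eventually (\<lambda>x. \<eta> x \<in> V) (nbhd_trace l)" using UV eventually_trace[OF assms(2)] by blast
  then have "eventually (\<lambda>x. \<eta> x \<in> V) (nbhd_trace k)" using assms(3) filter_leD by blast
  ultimately have "eventually (\<lambda>x. False) (nbhd_trace k)"
    by eventually_elim (use UV(5) in \<open>auto simp: disjnt_def\<close>)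
  then show False using trace_not_bot[OF assms(1)] by (simp add: trivial_limit_def)
qed

lemma inj_trace: "inj_on nbhd_trace (topspace K)"
  by (rule inj_onI) (simp add: trace_le_trace)

text \<open>
  Every Cauchy filter is finer than a trace, traces are Cauchy, and distinct traces are incomparable;
  so the minimal Cauchy filters are the traces.
\<close>

lemma completion_points_eq_traces:
  "completion_points X (median_uniformity X m) = nbhd_trace ` topspace K"
proof (intro equalityI subsetI)
  fix F assume "F \<in> completion_points X (median_uniformity X m)"
  then have F: "cauchy_filter X (median_uniformity X m) F"
      "\<And>G. cauchy_filter X (median_uniformity X m) G \<Longrightarrow> F \<le> G \<Longrightarrow> G = F"
    unfolding completion_points_def by simp_all
  obtain k where "k \<in> topspace K" "F \<le> nbhd_trace k" using cauchy_le_trace[OF F(1)] by blast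
  then show "F \<in> nbhd_trace ` topspace K" using F(2) cauchy_trace by blast
next
  fix F assume "F \<in> nbhd_trace ` topspace K"
  then obtain k where k: "k \<in> topspace K" "F = nbhd_trace k" by blast
  have "G = F" if G: "cauchy_filter X (median_uniformity X m) G" "F \<le> G" for G
  proof -
    obtain l where l: "l \<in> topspace K" "G \<le> nbhd_trace l" using cauchy_le_trace[OF G(1)] by blast
    then have "k = l" using trace_le_trace[of k l] k G(2) by auto
    then show ?thesis using l k G(2) by simp
  qed
  then show "F \<in> completion_points X (median_uniformity X m)"
    unfolding completion_points_def using cauchy_trace k by blast
qed

text \<open>
  Continuity holds because uniform covers of \<open>X\<close> are traces of open covers of \<open>K\<close>. For openness,
  a point \<open>l\<close> whose filter shares a member \<open>A\<close> of a fine cover with the filter of \<open>k\<close> is a limit of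
  \<open>A\<close>, so it lies in the closed set \<open>C\<close> inside the given neighbourhood of \<open>k\<close>.
\<close>

lemma homeomorphic_trace: "homeomorphic_map K (mmc_topology X m) nbhd_trace"
proof (rule bijective_open_imp_homeomorphic_map)
  have top: "topspace (mmc_topology X m) = nbhd_trace ` topspace K"
    using topspace_mmc_topology[OF M.ma] completion_points_eq_traces by simp
  then show "nbhd_trace ` topspace K = topspace (mmc_topology X m)" by simp
  show "inj_on nbhd_trace (topspace K)" by (rule inj_trace)
  show "continuous_map K (mmc_topology X m) nbhd_trace"
    unfolding continuous_map_def
  proof (intro conjI allI impI)
    show "nbhd_trace \<in> topspace K \<rightarrow> topspace (mmc_topology X m)" using top by blast
    fix G assume G: "openin (mmc_topology X m) G"
    show "openin K {k \<in> topspace K. nbhd_trace k \<in> G}"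
    proof (subst openin_subopen, intro ballI)
      fix k assume k: "k \<in> {k \<in> topspace K. nbhd_trace k \<in> G}"
      then obtain \<W> where \<W>: "\<W> \<in> completion_uniformity X (median_uniformity X m)"
          "cover_star (nbhd_trace k) \<W> \<subseteq> G"
        using G unfolding openin_mmc_topology[OF M.ma] by blast
      then obtain \<U> where \<U>: "\<U> \<in> median_uniformity X m"
          "cover_refines (extended_cover X (median_uniformity X m) \<U>) \<W>"
        unfolding completion_uniformity_def by blast
      obtain \<F> where \<F>: "finite \<F>" "\<F> \<subseteq> median_subbase X m"
          "cover_refines (cover_common_refinement X \<F>) \<U>"
        using \<U>(1) unfolding median_uniformity_def by blast
      obtain A W where AW: "A \<in> cover_common_refinement X \<F>" "openin K W" "k \<in> W"
          "\<And>x. x \<in> X \<Longrightarrow> \<eta> x \<in> W \<Longrightarrow> x \<in> A"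
        using refinement_member_near[OF \<F>(1,2), of k] k by blast
      obtain U where U: "U \<in> \<U>" "A \<subseteq> U" using \<F>(3) AW(1) unfolding cover_refines_def by blast
      have "nbhd_trace l \<in> {F \<in> completion_points X (median_uniformity X m). eventually (\<lambda>x. x \<in> U) F}"
        if "l \<in> W" for l
      proof -
        have l: "l \<in> topspace K" using that AW(2) openin_subset by blast
        then show ?thesis
          using that AW U unfolding completion_points_eq_traces by (auto simp: eventually_trace)
      qed
      moreover obtain Z where "Z \<in> \<W>"
        "{F \<in> completion_points X (median_uniformity X m). eventually (\<lambda>x. x \<in> U) F} \<subseteq> Z"
        using \<U>(2) U(1) unfolding cover_refines_def extended_cover_def by blast
      ultimately have "nbhd_trace l \<in> cover_star (nbhd_trace k) \<W>" if "l \<in> W" for l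
        using that AW(3) unfolding cover_star_def by blast
      then have "W \<subseteq> {k \<in> topspace K. nbhd_trace k \<in> G}"
        using \<W>(2) openin_subset[OF AW(2)] by blast
      then show "\<exists>T. openin K T \<and> k \<in> T \<and> T \<subseteq> {k \<in> topspace K. nbhd_trace k \<in> G}"
        using AW by blast
    qed
  qed
  show "open_map K (mmc_topology X m) nbhd_trace"
    unfolding open_map_def
  proof (intro allI impI)
    fix V assume V: "openin K V"
    show "openin (mmc_topology X m) (nbhd_trace ` V)"
      unfolding openin_mmc_topology[OF M.ma]
    proof (intro conjI ballI)
      show "nbhd_trace ` V \<subseteq> completion_points X (median_uniformity X m)"
        using openin_subset[OF V] completion_points_eq_traces by blast
      fix F assume "F \<in> nbhd_trace ` V"
      then obtain k where k: "k \<in> V" "F = nbhd_trace k" "k \<in> topspace K" using openin_subset[OF V] by blast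
      obtain \<F> W C where \<F>: "finite \<F>" "\<F> \<subseteq> median_subbase X m" "openin K W" "k \<in> W"
        "closedin K C" "C \<subseteq> V"
        "\<And>A x. A \<in> cover_common_refinement X \<F> \<Longrightarrow> x \<in> A \<Longrightarrow> \<eta> x \<in> W \<Longrightarrow> \<eta> ` A \<subseteq> C"
        using refinement_controls_neighbourhood[OF V k(1)] by metis
      let ?\<U> = "extended_cover X (median_uniformity X m) (cover_common_refinement X \<F>)"
      have "cover_star F ?\<U> \<subseteq> nbhd_trace ` V"
      proof
        fix F' assume "F' \<in> cover_star F ?\<U>"
        then obtain A where A: "A \<in> cover_common_refinement X \<F>" "eventually (\<lambda>x. x \<in> A) F"
            "eventually (\<lambda>x. x \<in> A) F'" "F' \<in> completion_points X (median_uniformity X m)"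
          unfolding cover_star_def extended_cover_def by blast
        then obtain l where l: "l \<in> topspace K" "F' = nbhd_trace l"
          unfolding completion_points_eq_traces by blast
        have "eventually (\<lambda>x. \<eta> x \<in> W) (nbhd_trace k)" using eventually_trace[OF k(3)] \<F>(3,4) by blast
        then have "eventually (\<lambda>x. x \<in> A \<and> \<eta> x \<in> W) (nbhd_trace k)"
          using A(2) unfolding k(2) by (simp add: eventually_conj)
        then obtain x where "x \<in> A" "\<eta> x \<in> W"
          using trace_not_bot[OF k(3)] eventually_happens' by blast
        then have AC: "\<eta> ` A \<subseteq> C" using \<F>(7) A(1) by blast
        have "l \<in> C"
        proof (rule ccontr)
          assume "l \<notin> C"
          then have "eventually (\<lambda>x. \<eta> x \<in> topspace K - C) (nbhd_trace l)"
            using \<F>(5) l(1) unfolding eventually_trace[OF l(1)] closedin_def by blast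
          then have "eventually (\<lambda>x. False) (nbhd_trace l)"
            using A(3) unfolding l(2) by eventually_elim (use AC in blast)
          then show False using trace_not_bot[OF l(1)] by (simp add: trivial_limit_def)
        qed
        then show "F' \<in> nbhd_trace ` V" using \<F>(6) l(2) by blast
      qed
      moreover have "?\<U> \<in> completion_uniformity X (median_uniformity X m)"
        using extended_cover_in_completion_uniformity refinement_in_uniformity[OF \<F>(1,2)] by blast
      ultimately show "\<exists>\<W>\<in>completion_uniformity X (median_uniformity X m). cover_star F \<W> \<subseteq> nbhd_trace ` V"
        by blast
    qed
  qed
qed

lemma topspace_median_topology: "topspace (median_topology X m) = X"
proof
  show "topspace (median_topology X m) \<subseteq> X"
    using openin_median_topology_iff openin_topspace by blast
  have "openin (median_topology X m) X"
    unfolding openin_median_topology_iff using eta_in openin_topspace by blast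
  then show "X \<subseteq> topspace (median_topology X m)" by (rule openin_subset)
qed

lemma openin_eta_preimage: "openin K W \<Longrightarrow> openin \<sigma> {x \<in> X. \<eta> x \<in> W}"
  by (rule openin_continuous_map_preimage[OF continuous])

lemma trace_eta:
  assumes x: "x \<in> X"
  shows "nbhd_trace (\<eta> x) = mmc_map X m x"
  unfolding filter_eq_iff
proof
  fix P
  have mmc: "mmc_map X m x = nhdsin (median_topology X m) x"
    unfolding mmc_map_def completion_map_def median_topology_def ..
  have "(\<exists>W. openin K W \<and> \<eta> x \<in> W \<and> (\<forall>y\<in>X. \<eta> y \<in> W \<longrightarrow> P y)) \<longleftrightarrow>
        (\<exists>S. openin (median_topology X m) S \<and> x \<in> S \<and> (\<forall>y\<in>S. P y))" (is "?L \<longleftrightarrow> ?R")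
  proof
    assume ?L
    then obtain W where W: "openin K W" "\<eta> x \<in> W" "\<forall>y\<in>X. \<eta> y \<in> W \<longrightarrow> P y" by blast
    have "openin (median_topology X m) {y \<in> X. \<eta> y \<in> W}"
      unfolding openin_median_topology_iff using W(1) by blast
    then show ?R using W x by blast
  next
    assume ?R
    then obtain S where S: "openin (median_topology X m) S" "x \<in> S" "\<forall>y\<in>S. P y" by blast
    then obtain W where "openin K W" "\<eta> x \<in> W" "\<forall>y\<in>X. \<eta> y \<in> W \<longrightarrow> y \<in> S"
      unfolding openin_median_topology_iff by blast
    then show ?L using S(3) by blast
  qed
  then show "eventually P (nbhd_trace (\<eta> x)) = eventually P (mmc_map X m x)"
    unfolding mmc eventually_nhdsin eventually_trace[OF eta_in[OF x]] topspace_median_topology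
    using x by simp
qed

text \<open>
  Injectivity being given, both conditions say that the topology of \<open>X\<close> is induced from \<open>K\<close>.
\<close>

lemma embedding_iff_median_topology: "embedding_map \<sigma> K \<eta> \<longleftrightarrow> \<sigma> = median_topology X m"
proof
  assume "embedding_map \<sigma> K \<eta>"
  then have hom: "homeomorphic_map \<sigma> (subtopology K (\<eta> ` X)) \<eta>" unfolding embedding_map_def .
  show "\<sigma> = median_topology X m"
    unfolding topology_eq
  proof (intro allI iffI)
    fix G assume G: "openin \<sigma> G"
    then have GX: "G \<subseteq> X" by (rule openin_subset)
    then have "openin (subtopology K (\<eta> ` X)) (\<eta> ` G)"
      using homeomorphic_map_openness[OF hom] G by blast
    then obtain V where V: "openin K V" "\<eta> ` G = V \<inter> \<eta> ` X" unfolding openin_subtopology by blast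
    have "y \<in> G" if "y \<in> X" "\<eta> y \<in> V" for y
    proof -
      have "\<eta> y \<in> \<eta> ` G" using V that by blast
      then show ?thesis using inj_on_image_mem_iff[OF inj] that GX by blast
    qed
    then show "openin (median_topology X m) G"
      unfolding openin_median_topology_iff using GX V by blast
  next
    fix G assume G: "openin (median_topology X m) G"
    show "openin \<sigma> G"
    proof (subst openin_subopen, intro ballI)
      fix x assume x: "x \<in> G"
      then obtain W where "openin K W" "\<eta> x \<in> W" "\<forall>y\<in>X. \<eta> y \<in> W \<longrightarrow> y \<in> G" "x \<in> X"
        using G unfolding openin_median_topology_iff by blast
      then show "\<exists>T. openin \<sigma> T \<and> x \<in> T \<and> T \<subseteq> G"
        using openin_eta_preimage by (intro exI[of _ "{x \<in> X. \<eta> x \<in> W}"]) blast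
    qed
  qed
next
  assume eq: "\<sigma> = median_topology X m"
  show "embedding_map \<sigma> K \<eta>"
    unfolding embedding_map_def
  proof (rule bijective_open_imp_homeomorphic_map)
    show "continuous_map \<sigma> (subtopology K (\<eta> ` X)) \<eta>"
      using continuous by (auto simp: continuous_map_in_subtopology)
    show "open_map \<sigma> (subtopology K (\<eta> ` X)) \<eta>"
      unfolding open_map_def
    proof (intro allI impI)
      fix G assume "openin \<sigma> G"
      then have "openin (median_topology X m) G" using eq by simp
      then have G: "G \<subseteq> X" "\<And>x. x \<in> G \<Longrightarrow> \<exists>W. openin K W \<and> \<eta> x \<in> W \<and> (\<forall>y\<in>X. \<eta> y \<in> W \<longrightarrow> y \<in> G)"
        unfolding openin_median_topology_iff by blast+
      show "openin (subtopology K (\<eta> ` X)) (\<eta> ` G)"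
      proof (subst openin_subopen, intro ballI)
        fix k assume "k \<in> \<eta> ` G"
        then obtain x where x: "x \<in> G" "k = \<eta> x" by blast
        obtain W where W: "openin K W" "\<eta> x \<in> W" "\<forall>y\<in>X. \<eta> y \<in> W \<longrightarrow> y \<in> G" using G(2)[OF x(1)] by blast
        have "openin (subtopology K (\<eta> ` X)) (W \<inter> \<eta> ` X)" using W(1) unfolding openin_subtopology by blast
        moreover have "k \<in> W \<inter> \<eta> ` X" using W x G(1) by blast
        moreover have "W \<inter> \<eta> ` X \<subseteq> \<eta> ` G" using W(3) by blast
        ultimately show "\<exists>T. openin (subtopology K (\<eta> ` X)) T \<and> k \<in> T \<and> T \<subseteq> \<eta> ` G" by blast
      qed
    qed
    show "\<eta> ` topspace \<sigma> = topspace (subtopology K (\<eta> ` X))"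
      using eta_in by (auto simp: topspace_subtopology)
  qed (rule inj)
qed

lemma Hausdorff_mmc: "Hausdorff_space (mmc_topology X m)"
  using homeomorphic_Hausdorff_space[OF homeomorphic_map_imp_homeomorphic_space[OF homeomorphic_trace]]
    Hausdorff by blast

text \<open>
  The median of \<open>K\<close>, carried over to the completion, is a continuous extension of the median of
  \<open>X\<close>, so the function chosen as median of the MMC is one, too. It is the same on all
  points of the completion, as the next lemma shows by density.
\<close>

lemma mmc_median_continuous_extends:
  "continuous_map
     (prod_topology (mmc_topology X m) (prod_topology (mmc_topology X m) (mmc_topology X m)))
     (mmc_topology X m) (\<lambda>(a, b, c). mmc_median X m a b c)" (is "?cont (mmc_median X m)")
  "x \<in> X \<Longrightarrow> y \<in> X \<Longrightarrow> z \<in> X \<Longrightarrow>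
     mmc_median X m (mmc_map X m x) (mmc_map X m y) (mmc_map X m z) = mmc_map X m (m x y z)"
proof -
  let ?L = "mmc_topology X m"
  obtain g where g: "homeomorphic_maps K ?L nbhd_trace g" using homeomorphic_trace homeomorphic_map_maps by blast
  then have cg: "continuous_map ?L K g" "\<And>k. k \<in> topspace K \<Longrightarrow> g (nbhd_trace k) = k"
    unfolding homeomorphic_maps_def by blast+
  define N where "N a b c = nbhd_trace (n (g a) (g b) (g c))" for a b c
  define extends where "extends n' \<longleftrightarrow> ?cont n' \<and> (\<forall>x\<in>X. \<forall>y\<in>X. \<forall>z\<in>X.
     n' (mmc_map X m x) (mmc_map X m y) (mmc_map X m z) = mmc_map X m (m x y z))" for n'
  have "?cont N"
  proof -
    let ?LLL = "prod_topology ?L (prod_topology ?L ?L)"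
    have "continuous_map ?LLL K (\<lambda>p. n (g (fst p)) (g (fst (snd p))) (g (snd (snd p))))"
      by (intro continuous_median continuous_map_compose[OF _ cg(1), unfolded o_def]
          continuous_map_fst continuous_map_snd
          continuous_map_compose[OF continuous_map_snd continuous_map_fst, unfolded o_def]
          continuous_map_compose[OF continuous_map_snd continuous_map_snd, unfolded o_def])
    then have "continuous_map ?LLL ?L (nbhd_trace \<circ> (\<lambda>p. n (g (fst p)) (g (fst (snd p))) (g (snd (snd p)))))"
      using homeomorphic_imp_continuous_map[OF homeomorphic_trace] continuous_map_compose by blast
    then show ?thesis unfolding N_def by (simp add: o_def case_prod_unfold)
  qed
  moreover have "N (mmc_map X m x) (mmc_map X m y) (mmc_map X m z) = mmc_map X m (m x y z)"
    if "x \<in> X" "y \<in> X" "z \<in> X" for x y z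
    unfolding N_def using that by (simp add: trace_eta[symmetric] cg eta_median)
  ultimately have N: "extends N" unfolding extends_def by simp
  have "mmc_median X m = (SOME n. extends n)" unfolding mmc_median_def extends_def ..
  then have "extends (mmc_median X m)" using someI[of extends, OF N] by simp
  then show "?cont (mmc_median X m)"
    "x \<in> X \<Longrightarrow> y \<in> X \<Longrightarrow> z \<in> X \<Longrightarrow>
     mmc_median X m (mmc_map X m x) (mmc_map X m y) (mmc_map X m z) = mmc_map X m (m x y z)"
    unfolding extends_def by simp_all
qed

lemma trace_median:
  assumes "a \<in> topspace K" "b \<in> topspace K" "c \<in> topspace K"
  shows "nbhd_trace (n a b c) = mmc_median X m (nbhd_trace a) (nbhd_trace b) (nbhd_trace c)"
proof -
  let ?L = "mmc_topology X m" and ?KKK = "prod_topology K (prod_topology K K)"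
  let ?LLL = "prod_topology ?L (prod_topology ?L ?L)" and ?S = "\<eta> ` X"
  have ct: "continuous_map K ?L nbhd_trace" using homeomorphic_imp_continuous_map[OF homeomorphic_trace] .
  have "continuous_map ?KKK K (\<lambda>p. n (fst p) (fst (snd p)) (snd (snd p)))"
    by (intro continuous_median continuous_map_fst
          continuous_map_compose[OF continuous_map_snd continuous_map_fst, unfolded o_def]
          continuous_map_compose[OF continuous_map_snd continuous_map_snd, unfolded o_def])
  then have 1: "continuous_map ?KKK ?L (nbhd_trace \<circ> (\<lambda>p. n (fst p) (fst (snd p)) (snd (snd p))))"
    using ct continuous_map_compose by blast
  have "continuous_map ?KKK ?LLL (\<lambda>p. (nbhd_trace (fst p), nbhd_trace (fst (snd p)), nbhd_trace (snd (snd p))))"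
    unfolding continuous_map_pairwise o_def fst_conv snd_conv
    by (intro conjI continuous_map_compose[OF _ ct, unfolded o_def] continuous_map_fst
          continuous_map_compose[OF continuous_map_snd continuous_map_fst, unfolded o_def]
          continuous_map_compose[OF continuous_map_snd continuous_map_snd, unfolded o_def])
  from continuous_map_compose[OF this mmc_median_continuous_extends(1)]
  have 2: "continuous_map ?KKK ?L
     (\<lambda>p. mmc_median X m (nbhd_trace (fst p)) (nbhd_trace (fst (snd p))) (nbhd_trace (snd (snd p))))"
    by (simp add: o_def)
  have cl: "(a, b, c) \<in> ?KKK closure_of (?S \<times> ?S \<times> ?S)"
    using assms by (simp add: closure_of_Times dense)
  have "(nbhd_trace \<circ> (\<lambda>p. n (fst p) (fst (snd p)) (snd (snd p)))) (a, b, c) =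
        (\<lambda>p. mmc_median X m (nbhd_trace (fst p)) (nbhd_trace (fst (snd p))) (nbhd_trace (snd (snd p)))) (a, b, c)"
  proof (rule forall_in_closure_of_eq[OF cl Hausdorff_mmc 1 2])
    fix p assume "p \<in> ?S \<times> ?S \<times> ?S"
    then obtain x y z where "x \<in> X" "y \<in> X" "z \<in> X" "p = (\<eta> x, \<eta> y, \<eta> z)" by auto
    then show "(nbhd_trace \<circ> (\<lambda>p. n (fst p) (fst (snd p)) (snd (snd p)))) p =
        mmc_median X m (nbhd_trace (fst p)) (nbhd_trace (fst (snd p))) (nbhd_trace (snd (snd p)))"
      using mmc_median_continuous_extends(2)[of x y z] by (simp add: trace_eta eta_median[symmetric])
  qed
  then show ?thesis by simp
qed

lemma isomorphic_to_mmc: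
  "isomorphic_compactifications X K n \<eta> (mmc_topology X m) (mmc_median X m) (mmc_map X m)"
  unfolding isomorphic_compactifications_def median_preserving_def
  by (intro exI[of _ nbhd_trace] conjI ballI) (simp_all add: homeomorphic_trace trace_median trace_eta)

lemma proper_median_compactification_mmc:
  assumes eq: "\<sigma> = median_topology X m"
  shows "proper_median_compactification \<sigma> m (mmc_topology X m) (mmc_median X m) (mmc_map X m)"
proof -
  let ?L = "mmc_topology X m"
  have top: "topspace ?L = nbhd_trace ` topspace K"
    using homeomorphic_imp_surjective_map[OF homeomorphic_trace] by simp
  have tX: "mmc_map X m ` X = nbhd_trace ` \<eta> ` X"
    unfolding image_image by (rule image_cong) (simp_all add: trace_eta)
  have "median_algebra (topspace ?L) (mmc_median X m)"
    unfolding median_algebra_def top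
    by (auto simp: trace_median[symmetric] N.assoc intro!: arg_cong[where f = nbhd_trace]
        intro: N.swap12 N.swap23)
  moreover have "compact_space ?L"
    using homeomorphic_compact_space[OF homeomorphic_map_imp_homeomorphic_space[OF homeomorphic_trace]]
      compact by blast
  moreover have "embedding_map \<sigma> ?L (mmc_map X m)"
  proof -
    have "embedding_map K ?L nbhd_trace"
      unfolding embedding_map_def using homeomorphic_trace top by (metis subtopology_topspace)
    then have "embedding_map \<sigma> ?L (nbhd_trace \<circ> \<eta>)"
      using embedding_iff_median_topology eq embedding_map_compose by blast
    then show ?thesis by (rule embedding_map_eq) (simp add: trace_eta)
  qed
  moreover have "continuous_map \<sigma> ?L (mmc_map X m)"
  proof -
    have "continuous_map \<sigma> ?L (nbhd_trace \<circ> \<eta>)"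
      using continuous homeomorphic_imp_continuous_map[OF homeomorphic_trace] continuous_map_compose by blast
    then show ?thesis by (rule continuous_map_eq) (simp add: trace_eta)
  qed
  moreover have "?L closure_of (mmc_map X m ` X) = topspace ?L"
  proof -
    have "\<eta> ` X \<subseteq> topspace K" using eta_in by blast
    from homeomorphic_map_closure_of[OF homeomorphic_trace this]
    show ?thesis unfolding tX top dense .
  qed
  ultimately show ?thesis
    unfolding proper_median_compactification_def median_compactification_def
      topological_median_algebra_def median_preserving_def
    by (intro conjI ballI Hausdorff_mmc mmc_median_continuous_extends(1)
        mmc_median_continuous_extends(2)[symmetric])
qed

end

section \<open>Criteria for separation by chains\<close>

text \<open>
  If no subbasic cover separated \<open>x\<close> from \<open>y\<close>, any common refinement would have a member that
  contains both, and no uniform neighbourhood of \<open>x\<close> would miss \<open>y\<close>.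
\<close>

lemma T2m_if_Hausdorff_median_topology:
  assumes ma: "median_algebra X m" and H: "Hausdorff_space (median_topology X m)"
    and top: "topspace (median_topology X m) = X"
  shows "T2m X m"
  unfolding T2m_def canonical_retraction_def
proof (intro ballI impI)
  fix x y assume xy: "x \<in> X" "y \<in> X" "x \<noteq> y"
  interpret M: median_alg X m by unfold_locales (rule ma)
  have "\<exists>U V. openin (median_topology X m) U \<and> openin (median_topology X m) V \<and> x \<in> U \<and> y \<in> V \<and> disjnt U V"
    using H xy unfolding Hausdorff_space_def top by simp
  then obtain U where U: "openin (median_topology X m) U" "x \<in> U" "y \<notin> U"
    by (auto simp: disjnt_def)
  then obtain \<U> where \<U>: "\<U> \<in> median_uniformity X m" "cover_star x \<U> \<subseteq> U"
    unfolding openin_median_topology[OF ma] by blast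
  obtain \<F> where \<F>: "finite \<F>" "\<F> \<subseteq> median_subbase X m" "cover_refines (cover_common_refinement X \<F>) \<U>"
    using \<U>(1) unfolding median_uniformity_def by blast
  have no: "\<not> (x \<in> A \<and> y \<in> A)" if "A \<in> cover_common_refinement X \<F>" for A
    using cover_star_mono[OF \<F>(3), of x] \<U>(2) U(3) that unfolding cover_star_def by blast
  have "\<exists>\<V>\<in>\<F>. \<forall>V\<in>\<V>. \<not> (x \<in> V \<and> y \<in> V)"
  proof (rule ccontr)
    assume "\<not> ?thesis"
    then have "\<forall>\<V>\<in>\<F>. \<exists>V. V \<in> \<V> \<and> x \<in> V \<and> y \<in> V" by blast
    then obtain s where s: "\<forall>\<V>\<in>\<F>. s \<V> \<in> \<V> \<and> x \<in> s \<V> \<and> y \<in> s \<V>" by metis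
    then have "X \<inter> (\<Inter>\<V>\<in>\<F>. s \<V>) \<in> cover_common_refinement X \<F>"
      unfolding cover_common_refinement_def by blast
    from no[OF this] show False using s xy by blast
  qed
  then obtain \<V> where \<V>: "\<V> \<in> median_subbase X m" "\<forall>V\<in>\<V>. \<not> (x \<in> V \<and> y \<in> V)" using \<F>(2) by blast
  then obtain u v where uv: "\<V> = {median_branch X m u v, median_branch X m v u}" "u \<in> X" "v \<in> X"
      "u \<noteq> v" "median_chain X m (median_interval X m u v)"
    unfolding median_subbase_def by blast
  have sw: "m v x u = m u x v" "m v y u = m u y v" using M.swap13 uv xy by simp_all
  have "m u x v = v \<or> m u y v = v" "m u x v = u \<or> m u y v = u"
    using \<V>(2) xy sw unfolding uv(1) median_branch_def by auto
  then have "{m u x v, m u y v} = {u, v}" using uv(4) by auto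
  then show "\<exists>u\<in>X. \<exists>v\<in>X. u \<noteq> v \<and> median_chain X m (median_interval X m u v) \<and> {m u x v, m u y v} = {u, v}"
    using uv by blast
qed

locale dense_median_map_compact_intervals = dense_median_map +
  assumes compact_intervals:
    "\<And>x y. x \<in> topspace \<sigma> \<Longrightarrow> y \<in> topspace \<sigma> \<Longrightarrow> compactin \<sigma> (median_interval (topspace \<sigma>) m x y)"
begin

text \<open>
  The retraction onto an interval of \<open>K\<close> with both ends in the image of \<open>X\<close> maps this image into
  the image of an interval of \<open>X\<close>. The latter is compact, hence closed in \<open>K\<close>, and by density it
  receives all values of the retraction.
\<close>

lemma image_convex:
  assumes "x \<in> X" "y \<in> X" "k \<in> topspace K" "N.btw (\<eta> x) k (\<eta> y)"
  obtains z where "z \<in> X" "M.btw x z y" "k = \<eta> z"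
proof -
  let ?I = "median_interval X m x y"
  have "closedin K (\<eta> ` ?I)"
    using compact_intervals[OF assms(1,2)] image_compactin continuous
      compactin_imp_closedin[OF Hausdorff] by blast
  then have cl: "closedin K {k \<in> topspace K. n (\<eta> x) k (\<eta> y) \<in> \<eta> ` ?I}"
    using closedin_continuous_map_preimage continuous_retraction assms eta_in by blast
  have "\<eta> z \<in> {k \<in> topspace K. n (\<eta> x) k (\<eta> y) \<in> \<eta> ` ?I}" if z: "z \<in> X" for z
  proof -
    have "m x z y \<in> ?I" using M.mem_interval[OF assms(1,2)] M.median_btw[of x z y] assms z by simp
    then have "\<eta> (m x z y) \<in> \<eta> ` ?I" by (rule imageI)
    then show ?thesis using z assms eta_median[of x z y] by simp
  qed
  then have "\<eta> ` X \<subseteq> {k \<in> topspace K. n (\<eta> x) k (\<eta> y) \<in> \<eta> ` ?I}" by (rule image_subsetI)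
  from closure_of_minimal[OF this cl] have "n (\<eta> x) k (\<eta> y) \<in> \<eta> ` ?I"
    unfolding dense using assms(3) by auto
  then have "k \<in> \<eta> ` ?I" using assms(4) unfolding N.btw_def by simp
  then show thesis using that M.mem_interval[OF assms(1,2)] by blast
qed

text \<open>
  A chain of \<open>K\<close> need not meet the image of \<open>X\<close>: it can be an edge of a square of which \<open>X\<close> is the
  interior. But if its retraction sends \<open>x\<close> and \<open>y\<close> in \<open>X\<close> to distinct points \<open>p\<close> and \<open>q\<close>, then the
  part from \<open>p\<close> to \<open>q\<close> has a parallel copy in the interval from \<open>x\<close> to \<open>y\<close>, which lies in the image by
  convexity. The retraction onto the copy is the retraction onto the original, followed by the
  translation, so it separates \<open>k\<close> and \<open>l\<close> as well.
\<close>

lemma transport_chain: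
  assumes K: "k \<in> topspace K" "l \<in> topspace K" and uv: "u \<in> topspace K" "v \<in> topspace K" "N.chain_between u v"
    and kl: "n u k v = u" "n u l v = v" and x: "x \<in> X" "y \<in> X"
    and pq: "n u (\<eta> x) v \<noteq> n u (\<eta> y) v" "N.btw u (n u (\<eta> x) v) (n u (\<eta> y) v)"
  shows "\<exists>a\<in>X. \<exists>b\<in>X. a \<noteq> b \<and> M.chain_between a b \<and> n (\<eta> a) k (\<eta> b) = \<eta> a \<and> n (\<eta> a) l (\<eta> b) = \<eta> b"
proof -
  define \<phi> \<psi> where "\<phi> z = n u z v" and "\<psi> z = n (\<eta> x) z (\<eta> y)" for z
  note ex = eta_in[OF x(1)] eta_in[OF x(2)]
  have \<phi>K[simp]: "\<phi> z \<in> topspace K" and \<psi>K[simp]: "\<psi> z \<in> topspace K" if "z \<in> topspace K" for z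
    using that uv ex by (simp_all add: \<phi>_def \<psi>_def)
  have \<phi>hom: "\<phi> (n a b c) = n (\<phi> a) (\<phi> b) (\<phi> c)" and \<psi>hom: "\<psi> (n a b c) = n (\<psi> a) (\<psi> b) (\<psi> c)"
    if "a \<in> topspace K" "b \<in> topspace K" "c \<in> topspace K" for a b c
    unfolding \<phi>_def \<psi>_def by (rule N.retraction_hom; use that uv ex in simp)+
  define p q where "p = \<phi> (\<eta> x)" and "q = \<phi> (\<eta> y)"
  have pqK[simp]: "p \<in> topspace K" "q \<in> topspace K" using ex by (simp_all add: p_def q_def)
  have pq': "p \<noteq> q" "N.btw u p q" using pq by (simp_all add: p_def q_def \<phi>_def)
  have i: "N.btw u p v" "N.btw u q v"
    unfolding p_def q_def \<phi>_def using uv ex by (simp_all add: N.median_btw)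
  have fixed: "\<phi> p = p" "\<phi> q = q" using i by (simp_all add: \<phi>_def N.btw_def)
  define p' q' where "p' = \<psi> p" and "q' = \<psi> q"
  have pqK'[simp]: "p' \<in> topspace K" "q' \<in> topspace K" by (simp_all add: p'_def q'_def)
  have \<phi>p: "\<phi> p' = p" and \<phi>q: "\<phi> q' = q"
  proof -
    have "\<phi> p' = n p (\<phi> p) q" unfolding p'_def \<psi>_def p_def q_def by (rule \<phi>hom) (simp_all add: ex)
    then show "\<phi> p' = p" using fixed by simp
    have "\<phi> q' = n p (\<phi> q) q" unfolding q'_def \<psi>_def p_def q_def by (rule \<phi>hom) (simp_all add: ex)
    then show "\<phi> q' = q" using fixed by simp
  qed
  have i': "N.btw (\<eta> x) p' (\<eta> y)" "N.btw (\<eta> x) q' (\<eta> y)"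
    unfolding p'_def q'_def \<psi>_def using ex by (simp_all add: N.median_btw)
  \<comment> \<open>The retractions restrict to mutually inverse bijections between the original and its copy.\<close>
  have \<phi>z: "N.btw p (\<phi> z) q" "\<psi> (\<phi> z) = z" if z: "z \<in> topspace K" "N.btw p' z q'" for z
  proof -
    have "N.btw (\<phi> p') (\<phi> z) (\<phi> q')"
      unfolding \<phi>_def by (rule N.retraction_btw) (use uv z in simp_all)
    then show 1: "N.btw p (\<phi> z) q" using \<phi>p \<phi>q by simp
    have "N.btw (\<eta> x) z (\<eta> y)"
      by (rule N.interval_convex[of _ _ p' q']) (use ex z i' in simp_all)
    then have "\<psi> z = z" by (simp add: \<psi>_def N.btw_def)
    then have "z = n (\<psi> p) (\<psi> z) (\<psi> q)" using z(2) by (simp add: N.btw_def p'_def q'_def)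
    also have "\<dots> = \<psi> (n p z q)" using z by (simp add: \<psi>hom)
    also have "n p z q = n p (\<phi> z) q"
      unfolding \<phi>_def by (rule N.retraction_absorb[symmetric]) (use uv z i in simp_all)
    also have "\<dots> = \<phi> z" using 1 by (simp add: N.btw_def)
    finally show "\<psi> (\<phi> z) = z" by simp
  qed
  have chain_between_pq: "N.chain_between p q" by (rule N.chain_between_subinterval[of u v]) (use uv i in simp_all)
  have \<psi>btw: "N.btw p' z w" if "z \<in> topspace K" "w \<in> topspace K" "N.btw p' z q'" "N.btw p' w q'"
    "N.btw p (\<phi> z) (\<phi> w)" for z w
  proof -
    have "N.btw (\<psi> p) (\<psi> (\<phi> z)) (\<psi> (\<phi> w))"
      unfolding \<psi>_def by (rule N.retraction_btw) (use ex that in simp_all)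
    then show ?thesis using \<phi>z that by (simp add: p'_def)
  qed
  have chain_between': "N.chain_between p' q'"
    unfolding N.chain_between_def
  proof (intro ballI impI)
    fix z w assume zw: "z \<in> topspace K" "w \<in> topspace K" "N.btw p' z q'" "N.btw p' w q'"
    have "N.btw p (\<phi> z) (\<phi> w) \<or> N.btw p (\<phi> w) (\<phi> z)"
      using chain_between_pq \<phi>K[OF zw(1)] \<phi>K[OF zw(2)] \<phi>z(1)[OF zw(1,3)] \<phi>z(1)[OF zw(2,4)]
      unfolding N.chain_between_def by simp
    then show "N.btw p' z w \<or> N.btw p' w z" using \<psi>btw[of z w] \<psi>btw[of w z] zw by argo
  qed
  have retract: "n p' z q' = \<psi> (n p (\<phi> z) q)" if z: "z \<in> topspace K" for z
  proof -
    have "n p' z q' = \<psi> (\<phi> (n p' z q'))" using \<phi>z(2)[of "n p' z q'"] z by (simp add: N.median_btw)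
    also have "\<phi> (n p' z q') = n p (\<phi> z) q" using z by (simp add: \<phi>hom \<phi>p \<phi>q)
    finally show ?thesis .
  qed
  have "n p (\<phi> k) q = p"
  proof -
    have "n p u q = n u p q" using uv by (simp add: N.swap12)
    then show ?thesis using pq'(2) kl by (simp add: \<phi>_def N.btw_def)
  qed
  then have vk: "n p' k q' = p'" using retract[OF K(1)] by (simp add: p'_def)
  have "n p (\<phi> l) q = q"
  proof -
    have "N.btw p q v" by (rule N.btw_shift[of u]) (use uv i pq' in simp_all)
    then show ?thesis using kl uv N.swap23[of p v q] by (simp add: \<phi>_def N.btw_def)
  qed
  then have vl: "n p' l q' = q'" using retract[OF K(2)] by (simp add: q'_def)
  obtain a where a: "a \<in> X" "p' = \<eta> a" using image_convex[OF x, of p'] i' by auto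
  obtain b where b: "b \<in> X" "q' = \<eta> b" using image_convex[OF x, of q'] i' by auto
  have "M.chain_between a b"
    using chain_between' unfolding N.chain_between_def M.chain_between_def a(2) b(2) using a(1) b(1) eta_in btw_eta by metis
  moreover have "a \<noteq> b" using \<phi>p \<phi>q pq' a b by auto
  ultimately show ?thesis using vk vl a b by blast
qed

text \<open>
  A retraction that takes different values at \<open>k\<close> and \<open>l\<close> is not constant on the dense set \<open>X\<close>.
\<close>

lemma chain_separated_if_T2m:
  assumes T2: "T2m (topspace K) n"
  shows "chain_separated X m (topspace K) n \<eta>"
  unfolding chain_separated_def
proof (intro ballI impI)
  fix k l assume K: "k \<in> topspace K" "l \<in> topspace K" and ne: "k \<noteq> l"
  obtain u v where uv: "u \<in> topspace K" "v \<in> topspace K" "N.chain_between u v" and kl: "n u k v = u" "n u l v = v" "u \<noteq> v"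
  proof -
    obtain u v where uv: "u \<in> topspace K" "v \<in> topspace K" "u \<noteq> v" "N.chain_between u v" "{n u k v, n u l v} = {u, v}"
      using T2 K ne N.median_chain_iff_chain_between unfolding T2m_def canonical_retraction_def by metis
    then consider "n u k v = u" "n u l v = v" | "n u k v = v" "n u l v = u" by (metis doubleton_eq_iff)
    then show thesis
    proof cases
      case 1 then show thesis using that uv by blast
    next
      case 2
      then have "n v k u = v" "n v l u = u"
        using N.swap13[of u k v] N.swap13[of u l v] uv K by simp_all
      then show thesis using that[of v u] uv N.chain_between_sym[of u v] by simp
    qed
  qed
  have "\<exists>x\<in>X. \<exists>y\<in>X. n u (\<eta> x) v \<noteq> n u (\<eta> y) v"
  proof (rule ccontr)
    assume *: "\<not> ?thesis"
    have "X \<noteq> {}" using dense K(1) by auto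
    then obtain c where c: "c \<in> X" by blast
    have const: "continuous_map K K (\<lambda>_. n u (\<eta> c) v)" using c uv by simp
    have all: "n u z v = n u (\<eta> c) v" if z: "z \<in> topspace K" for z
    proof (rule forall_in_closure_of_eq[of z K "\<eta> ` X" K, OF _ Hausdorff])
      show "z \<in> K closure_of (\<eta> ` X)" using z dense by simp
      show "continuous_map K K (\<lambda>z. n u z v)" using continuous_retraction uv by simp
      show "continuous_map K K (\<lambda>z. n u (\<eta> c) v)" by (rule const)
      show "\<And>w. w \<in> \<eta> ` X \<Longrightarrow> n u w v = n u (\<eta> c) v" using * c by blast
    qed
    show False using all[OF K(1)] all[OF K(2)] kl by simp
  qed
  then obtain x y where x: "x \<in> X" "y \<in> X" "n u (\<eta> x) v \<noteq> n u (\<eta> y) v" by blast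
  have "N.btw u (n u (\<eta> x) v) (n u (\<eta> y) v) \<or> N.btw u (n u (\<eta> y) v) (n u (\<eta> x) v)"
    using uv x unfolding N.chain_between_def by (simp add: N.median_btw)
  then have "\<exists>a\<in>X. \<exists>b\<in>X. a \<noteq> b \<and> M.chain_between a b \<and> n (\<eta> a) k (\<eta> b) = \<eta> a \<and> n (\<eta> a) l (\<eta> b) = \<eta> b"
    using transport_chain[OF K uv kl(1,2) x(1,2)] transport_chain[OF K uv kl(1,2) x(2,1)] x(3) by metis
  then show "\<exists>a\<in>X. \<exists>b\<in>X. a \<noteq> b \<and> median_chain X m (median_interval X m a b) \<and>
     n (\<eta> a) k (\<eta> b) = \<eta> a \<and> n (\<eta> a) l (\<eta> b) = \<eta> b"
    using M.median_chain_iff_chain_between by simp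
qed

text \<open>
  For \<open>x\<close> near \<open>k\<close> and \<open>y\<close> near \<open>l\<close> the retraction onto the interval from \<open>x\<close> to \<open>y\<close> hardly moves
  \<open>k\<close> and \<open>l\<close>, so their images \<open>p\<close> and \<open>q\<close> are distinct; by convexity these belong to \<open>X\<close>. A chain
  that separates \<open>p\<close> from \<open>q\<close> inside this interval then separates \<open>k\<close> from \<open>l\<close>.
\<close>

lemma chain_separated_if_finite_rank:
  assumes rank: "median_rank X m \<noteq> \<infinity>"
  shows "chain_separated X m (topspace K) n \<eta>"
  unfolding chain_separated_def
proof (intro ballI impI)
  fix k l assume K: "k \<in> topspace K" "l \<in> topspace K" and ne: "k \<noteq> l"
  then have "\<exists>U V. openin K U \<and> openin K V \<and> k \<in> U \<and> l \<in> V \<and> disjnt U V"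
    using Hausdorff unfolding Hausdorff_space_def by simp
  then obtain U V where UV: "openin K U" "openin K V" "k \<in> U" "l \<in> V" "disjnt U V"
    by (elim exE conjE)
  let ?KK = "prod_topology K K"
  have c: "continuous_map ?KK K (\<lambda>p. n (fst p) z (snd p))" if "z \<in> topspace K" for z
    by (intro continuous_median continuous_map_fst continuous_map_snd) (use that in simp)
  define A where "A = {p \<in> topspace ?KK. n (fst p) k (snd p) \<in> U}"
  define B where "B = {p \<in> topspace ?KK. n (fst p) l (snd p) \<in> V}"
  have "openin ?KK A" "openin ?KK B"
    unfolding A_def B_def using openin_continuous_map_preimage c K UV by blast+
  then have "openin ?KK (A \<inter> B)" by (rule openin_Int)
  moreover have "(k, l) \<in> A \<inter> B" using K UV by (simp add: A_def B_def)
  moreover have "(k, l) \<in> ?KK closure_of (\<eta> ` X \<times> \<eta> ` X)" using K by (simp add: closure_of_Times dense)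
  ultimately obtain p where p: "p \<in> \<eta> ` X \<times> \<eta> ` X" "p \<in> A \<inter> B" unfolding in_closure_of by blast
  from p(1) obtain x y where xy: "x \<in> X" "y \<in> X" "p = (\<eta> x, \<eta> y)" by (elim SigmaE imageE) simp
  then have x: "x \<in> X" "y \<in> X" "n (\<eta> x) k (\<eta> y) \<in> U" "n (\<eta> x) l (\<eta> y) \<in> V"
    using p(2) by (simp_all add: A_def B_def)
  have ex: "\<eta> x \<in> topspace K" "\<eta> y \<in> topspace K" using x by simp_all
  obtain p where p: "p \<in> X" "M.btw x p y" "n (\<eta> x) k (\<eta> y) = \<eta> p"
    using image_convex[OF x(1,2), of "n (\<eta> x) k (\<eta> y)"] K ex by (auto simp: N.median_btw)
  obtain q where q: "q \<in> X" "M.btw x q y" "n (\<eta> x) l (\<eta> y) = \<eta> q"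
    using image_convex[OF x(1,2), of "n (\<eta> x) l (\<eta> y)"] K ex by (auto simp: N.median_btw)
  have "p \<noteq> q" using x p q UV(5) by (auto simp: disjnt_def)
  then obtain a b where ab: "a \<in> X" "b \<in> X" "a \<noteq> b" "M.btw p a q" "M.btw p b q" "M.chain_between a b"
      "m a p b = a" "m a q b = b"
    using M.exists_separating_chain[OF rank p(1) q(1)] by blast
  have "M.btw x a y" by (rule M.interval_convex[of _ _ p q]) (use ab p q x in simp_all)
  then have a: "N.btw (\<eta> x) (\<eta> a) (\<eta> y)" using btw_eta x ab by simp
  have "M.btw x b y" by (rule M.interval_convex[of _ _ p q]) (use ab p q x in simp_all)
  then have b: "N.btw (\<eta> x) (\<eta> b) (\<eta> y)" using btw_eta x ab by simp
  have "n (\<eta> a) (n (\<eta> x) z (\<eta> y)) (\<eta> b) = n (\<eta> a) z (\<eta> b)" if "z \<in> topspace K" for z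
    by (rule N.retraction_absorb) (use that ex ab a b in simp_all)
  then have "n (\<eta> a) k (\<eta> b) = n (\<eta> a) (\<eta> p) (\<eta> b)" "n (\<eta> a) l (\<eta> b) = n (\<eta> a) (\<eta> q) (\<eta> b)"
    using p q K by metis+
  then have "n (\<eta> a) k (\<eta> b) = \<eta> a" "n (\<eta> a) l (\<eta> b) = \<eta> b"
    using eta_median[of a p b] eta_median[of a q b] ab p q by simp_all
  then show "\<exists>a\<in>X. \<exists>b\<in>X. a \<noteq> b \<and> median_chain X m (median_interval X m a b) \<and>
     n (\<eta> a) k (\<eta> b) = \<eta> a \<and> n (\<eta> a) l (\<eta> b) = \<eta> b"
    using M.median_chain_iff_chain_between ab by (intro bexI[of _ a] bexI[of _ b]) simp_all
qed

end

section \<open>The closure in the product of chain intervals\<close>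

text \<open>
  The compactification used for existence is the closure of \<open>X\<close> in the product of all its chain
  intervals, into which the retractions map \<open>X\<close>. Each factor is compact by hypothesis.
\<close>

locale compact_interval_median_algebra =
  fixes \<sigma> :: "'a topology" and m :: "'a \<Rightarrow> 'a \<Rightarrow> 'a \<Rightarrow> 'a"
  assumes tma: "topological_median_algebra \<sigma> m"
    and T2m: "T2m (topspace \<sigma>) m"
    and compact_intervals:
      "\<And>x y. x \<in> topspace \<sigma> \<Longrightarrow> y \<in> topspace \<sigma> \<Longrightarrow> compactin \<sigma> (median_interval (topspace \<sigma>) m x y)"
begin

sublocale M: median_alg "topspace \<sigma>" m
  using tma unfolding topological_median_algebra_def by unfold_locales blast

abbreviation X :: "'a set" where "X \<equiv> topspace \<sigma>"

definition chains :: "('a \<times> 'a) set" where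
  "chains = {(u, v). u \<in> X \<and> v \<in> X \<and> u \<noteq> v \<and> M.chain_between u v}"

definition chain_space :: "'a \<times> 'a \<Rightarrow> 'a topology" where
  "chain_space i = subtopology \<sigma> (median_interval X m (fst i) (snd i))"

definition chain_product :: "('a \<times> 'a \<Rightarrow> 'a) topology" where
  "chain_product = product_topology chain_space chains"

definition chain_map :: "'a \<Rightarrow> 'a \<times> 'a \<Rightarrow> 'a" where
  "chain_map x = (\<lambda>i\<in>chains. m (fst i) x (snd i))"

definition pointwise_median ::
    "('a \<times> 'a \<Rightarrow> 'a) \<Rightarrow> ('a \<times> 'a \<Rightarrow> 'a) \<Rightarrow> ('a \<times> 'a \<Rightarrow> 'a) \<Rightarrow> 'a \<times> 'a \<Rightarrow> 'a" where
  "pointwise_median f g h = (\<lambda>i\<in>chains. m (f i) (g i) (h i))"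

definition chain_compactification :: "('a \<times> 'a \<Rightarrow> 'a) topology" where
  "chain_compactification = subtopology chain_product (chain_product closure_of (chain_map ` X))"

lemma chainsD: "i \<in> chains \<Longrightarrow> fst i \<in> X \<and> snd i \<in> X \<and> fst i \<noteq> snd i \<and> M.chain_between (fst i) (snd i)"
  by (auto simp: chains_def)

lemma topspace_chain_space:
  assumes "i \<in> chains"
  shows "topspace (chain_space i) = {z \<in> X. M.btw (fst i) z (snd i)}"
  using M.mem_interval chainsD[OF assms] unfolding chain_space_def topspace_subtopology by auto

lemma chain_product_component:
  assumes "f \<in> topspace chain_product" "i \<in> chains"
  shows "f i \<in> X" "M.btw (fst i) (f i) (snd i)"
proof -
  have "f i \<in> topspace (chain_space i)" using assms unfolding chain_product_def by auto
  then show "f i \<in> X" "M.btw (fst i) (f i) (snd i)" using topspace_chain_space[OF assms(2)] by auto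
qed

lemma chain_product_ext:
  assumes "f \<in> topspace chain_product" "g \<in> topspace chain_product" "\<And>i. i \<in> chains \<Longrightarrow> f i = g i"
  shows "f = g"
  using assms unfolding chain_product_def topspace_product_topology by (rule PiE_ext)

lemma continuous_into_chain_product:
  assumes "\<And>i. i \<in> chains \<Longrightarrow> continuous_map S \<sigma> (\<lambda>s. f s i)"
    and "\<And>i s. i \<in> chains \<Longrightarrow> s \<in> topspace S \<Longrightarrow> M.btw (fst i) (f s i) (snd i)"
    and "\<And>i s. i \<notin> chains \<Longrightarrow> f s i = undefined"
  shows "continuous_map S chain_product f"
  unfolding chain_product_def
proof (rule continuous_map_coordinatewise_then_product)
  fix i assume i: "i \<in> chains"
  have "f s i \<in> X" if "s \<in> topspace S" for s
    using continuous_map_funspace[OF assms(1)[OF i]] that by blast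
  then show "continuous_map S (chain_space i) (\<lambda>s. f s i)"
    unfolding chain_space_def continuous_map_in_subtopology
    using assms(1,2)[OF i] M.mem_interval chainsD[OF i] by auto
qed (use assms(3) in simp)

lemma continuous_chain_product_component:
  assumes "i \<in> chains"
  shows "continuous_map chain_product \<sigma> (\<lambda>f. f i)"
proof -
  have "continuous_map chain_product (chain_space i) (\<lambda>f. f i)"
    unfolding chain_product_def using assms by simp
  then show ?thesis unfolding chain_space_def continuous_map_in_subtopology by blast
qed

lemma continuous_chain_map: "continuous_map \<sigma> chain_product chain_map"
proof (rule continuous_into_chain_product)
  fix i assume i: "i \<in> chains"
  have "continuous_map \<sigma> \<sigma> (\<lambda>x. m (fst i) x (snd i))"
    by (rule continuous_map_median[OF tma]) (use chainsD[OF i] in simp_all)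
  then show "continuous_map \<sigma> \<sigma> (\<lambda>x. chain_map x i)" using i by (simp add: chain_map_def)
  show "M.btw (fst i) (chain_map x i) (snd i)" if "x \<in> X" for x
    using i that chainsD[OF i] by (simp add: chain_map_def M.median_btw)
qed (simp add: chain_map_def)

lemma continuous_pointwise_median:
  assumes "continuous_map S chain_product f" "continuous_map S chain_product g"
    "continuous_map S chain_product h"
  shows "continuous_map S chain_product (\<lambda>s. pointwise_median (f s) (g s) (h s))"
proof (rule continuous_into_chain_product)
  fix i assume i: "i \<in> chains"
  have "continuous_map S \<sigma> (\<lambda>s. m (f s i) (g s i) (h s i))"
    by (intro continuous_map_median[OF tma]
        assms[THEN continuous_map_compose[OF _ continuous_chain_product_component[OF i], unfolded o_def]])
  then show "continuous_map S \<sigma> (\<lambda>s. pointwise_median (f s) (g s) (h s) i)"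
    using i by (simp add: pointwise_median_def)
  fix s assume s: "s \<in> topspace S"
  have c: "f s \<in> topspace chain_product" "g s \<in> topspace chain_product" "h s \<in> topspace chain_product"
    using assms[THEN continuous_map_funspace] s by blast+
  note c = c[THEN chain_product_component(1), OF i] c[THEN chain_product_component(2), OF i]
  show "M.btw (fst i) (pointwise_median (f s) (g s) (h s) i) (snd i)"
    using M.interval_convex[of "fst i" "snd i" "f s i" "g s i" "m (f s i) (g s i) (h s i)"]
      chainsD[OF i] c M.median_btw[of "f s i" "g s i" "h s i"] i
    by (simp add: pointwise_median_def)
qed (simp add: pointwise_median_def)

lemma pointwise_median_in:
  assumes "f \<in> topspace chain_product" "g \<in> topspace chain_product" "h \<in> topspace chain_product"
  shows "pointwise_median f g h \<in> topspace chain_product"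
proof -
  have "continuous_map chain_product chain_product (\<lambda>_. pointwise_median f g h)"
    by (rule continuous_pointwise_median) (use assms in simp_all)
  from continuous_map_funspace[OF this] show ?thesis using assms(1) by blast
qed

lemma chain_map_median:
  assumes "x \<in> X" "y \<in> X" "z \<in> X"
  shows "chain_map (m x y z) = pointwise_median (chain_map x) (chain_map y) (chain_map z)"
proof
  fix i
  show "chain_map (m x y z) i = pointwise_median (chain_map x) (chain_map y) (chain_map z) i"
  proof (cases "i \<in> chains")
    case True
    then show ?thesis
      using chainsD[OF True] M.retraction_hom[of "fst i" "snd i" x y z] assms by (simp add: chain_map_def pointwise_median_def)
  qed (simp add: chain_map_def pointwise_median_def)
qed

lemma topspace_chain_compactification:
  "topspace chain_compactification = chain_product closure_of (chain_map ` X)"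
  unfolding chain_compactification_def topspace_subtopology
  by (rule inf.absorb2) (rule closure_of_subset_topspace)

lemma chain_compactification_subset: "topspace chain_compactification \<subseteq> topspace chain_product"
  unfolding topspace_chain_compactification by (rule closure_of_subset_topspace)

lemma pointwise_median_closed:
  assumes "f \<in> topspace chain_compactification" "g \<in> topspace chain_compactification"
    "h \<in> topspace chain_compactification"
  shows "pointwise_median f g h \<in> topspace chain_compactification"
proof -
  let ?P = chain_product and ?S = "chain_map ` X"
  let ?PPP = "prod_topology ?P (prod_topology ?P ?P)"
  let ?n = "\<lambda>p. pointwise_median (fst p) (fst (snd p)) (snd (snd p))"
  have "continuous_map ?PPP ?P ?n"
    by (intro continuous_pointwise_median continuous_map_fst
          continuous_map_compose[OF continuous_map_snd continuous_map_fst, unfolded o_def]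
          continuous_map_compose[OF continuous_map_snd continuous_map_snd, unfolded o_def])
  from continuous_map_image_closure_subset[OF this]
  have "?n ` (?PPP closure_of (?S \<times> ?S \<times> ?S)) \<subseteq> ?P closure_of (?n ` (?S \<times> ?S \<times> ?S))" .
  moreover have "?n ` (?S \<times> ?S \<times> ?S) \<subseteq> ?S"
  proof (rule image_subsetI)
    fix p assume "p \<in> ?S \<times> ?S \<times> ?S"
    then obtain x y z where "x \<in> X" "y \<in> X" "z \<in> X" "p = (chain_map x, chain_map y, chain_map z)"
      by (elim SigmaE imageE) simp
    then show "?n p \<in> ?S" by (simp add: chain_map_median[symmetric])
  qed
  then have "?P closure_of (?n ` (?S \<times> ?S \<times> ?S)) \<subseteq> ?P closure_of ?S" by (rule closure_of_mono)
  moreover have "(f, g, h) \<in> ?PPP closure_of (?S \<times> ?S \<times> ?S)"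
    using assms by (simp add: closure_of_Times topspace_chain_compactification)
  then have "?n (f, g, h) \<in> ?n ` (?PPP closure_of (?S \<times> ?S \<times> ?S))" by (rule imageI)
  ultimately have "?n (f, g, h) \<in> ?P closure_of ?S" by (meson subset_iff)
  then show ?thesis by (simp add: topspace_chain_compactification)
qed

lemma median_algebra_chain_compactification:
  "median_algebra (topspace chain_compactification) pointwise_median"
proof -
  note sub = chain_compactification_subset[THEN subsetD]
  note c = chain_product_component(1)[OF sub]
  show ?thesis
    unfolding median_algebra_def
  proof (intro conjI ballI)
    fix a b c x
    assume a: "a \<in> topspace chain_compactification" and b: "b \<in> topspace chain_compactification"
    note ab = c[OF a] c[OF b]
    show "pointwise_median a b b = b"
    proof (rule chain_product_ext)
      show "pointwise_median a b b \<in> topspace chain_product"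
        by (rule pointwise_median_in) (use sub a b in blast)+
      show "b \<in> topspace chain_product" using sub b by blast
      show "pointwise_median a b b i = b i" if "i \<in> chains" for i
        using that ab[OF that] by (simp add: pointwise_median_def)
    qed
    assume cc: "c \<in> topspace chain_compactification"
    note abc = ab c[OF cc]
    show "pointwise_median a b c \<in> topspace chain_compactification"
      using pointwise_median_closed a b cc by simp
    show "pointwise_median a b c = pointwise_median b a c"
      unfolding pointwise_median_def using abc M.swap12 by (intro restrict_ext) simp
    show "pointwise_median a b c = pointwise_median a c b"
      unfolding pointwise_median_def using abc M.swap23 by (intro restrict_ext) simp
    assume xx: "x \<in> topspace chain_compactification"
    show "pointwise_median (pointwise_median a x b) x c = pointwise_median a x (pointwise_median b x c)"
      unfolding pointwise_median_def using abc c[OF xx] M.assoc by (intro restrict_ext) simp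
  qed
qed

lemma dense_median_map_chain_map:
  "dense_median_map \<sigma> m chain_compactification pointwise_median chain_map"
proof
  let ?K = chain_compactification
  have HK: "Hausdorff_space ?K"
    unfolding chain_compactification_def chain_product_def chain_space_def
    using tma unfolding topological_median_algebra_def
    by (simp add: Hausdorff_space_subtopology Hausdorff_space_product_topology)
  have id: "continuous_map ?K chain_product (\<lambda>f. f)"
    unfolding chain_compactification_def by (simp add: continuous_map_from_subtopology)
  let ?KKK = "prod_topology ?K (prod_topology ?K ?K)"
  let ?n = "\<lambda>p. pointwise_median (fst p) (fst (snd p)) (snd (snd p))"
  have "continuous_map ?KKK chain_product ?n"
    by (intro continuous_pointwise_median continuous_map_compose[OF _ id, unfolded o_def]
          continuous_map_fst
          continuous_map_compose[OF continuous_map_snd continuous_map_fst, unfolded o_def]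
          continuous_map_compose[OF continuous_map_snd continuous_map_snd, unfolded o_def])
  moreover have "?n \<in> topspace ?KKK \<rightarrow> chain_product closure_of (chain_map ` X)"
    using pointwise_median_closed by (auto simp: topspace_chain_compactification[symmetric])
  ultimately have "continuous_map ?KKK ?K ?n"
    unfolding chain_compactification_def continuous_map_in_subtopology by blast
  then show "topological_median_algebra ?K pointwise_median"
    unfolding topological_median_algebra_def
    using HK median_algebra_chain_compactification by (simp add: case_prod_unfold)
  have "compact_space (chain_space i)" if "i \<in> chains" for i
    unfolding chain_space_def
    using chainsD[OF that] compact_intervals by (simp add: compact_space_subtopology)
  then have "compact_space chain_product"
    unfolding chain_product_def compact_space_product_topology by blast
  then show "compact_space ?K"
    unfolding chain_compactification_def
    by (intro compact_space_subtopology closedin_compact_space) simp_all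
  have sub: "chain_map ` X \<subseteq> topspace chain_product"
    using continuous_map_image_subset_topspace[OF continuous_chain_map] .
  show "continuous_map \<sigma> ?K chain_map"
    unfolding chain_compactification_def continuous_map_in_subtopology
    using continuous_chain_map closure_of_subset[OF sub] by blast
  show "median_preserving X m pointwise_median chain_map"
    unfolding median_preserving_def using chain_map_median by blast
  show "?K closure_of (chain_map ` X) = topspace ?K"
    using closure_of_subset[OF sub] unfolding topspace_chain_compactification
    unfolding chain_compactification_def closure_of_subtopology by (simp add: inf.absorb2)
  show "inj_on chain_map X"
  proof (rule inj_onI)
    fix x y assume xy: "x \<in> X" "y \<in> X" and eq: "chain_map x = chain_map y"
    show "x = y"
    proof (rule ccontr)
      assume "x \<noteq> y"
      then obtain u v where uv: "u \<in> X" "v \<in> X" "u \<noteq> v" "M.chain_between u v" "{m u x v, m u y v} = {u, v}"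
        using T2m xy M.median_chain_iff_chain_between unfolding T2m_def canonical_retraction_def by metis
      have i: "(u, v) \<in> chains" using uv by (simp add: chains_def)
      then have "m u x v = m u y v"
        using fun_cong[OF eq, of "(u, v)"] by (simp add: chain_map_def)
      then show False using uv(3,5) by auto
    qed
  qed
qed (rule tma)

text \<open>
  Points that differ at the chain \<open>i\<close> have distinct coordinates \<open>p\<close> and \<open>q\<close> there, and these are
  points of \<open>X\<close>. The retraction of the product onto the interval from \<open>p\<close> to \<open>q\<close> depends on the
  coordinate at \<open>i\<close> only: this is true on the image of \<open>X\<close>, hence on its closure.
\<close>

lemma separated_chain_map:
  "separated_median_map \<sigma> m chain_compactification pointwise_median chain_map"
proof -
  interpret D: dense_median_map \<sigma> m chain_compactification pointwise_median chain_map
    by (rule dense_median_map_chain_map)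
  let ?K = chain_compactification
  show ?thesis
  proof
    show "chain_separated X m (topspace ?K) pointwise_median chain_map"
      unfolding chain_separated_def
    proof (intro ballI impI)
      fix f g assume f: "f \<in> topspace ?K" and g: "g \<in> topspace ?K" and ne: "f \<noteq> g"
      note fP = chain_compactification_subset[THEN subsetD, OF f]
      note gP = chain_compactification_subset[THEN subsetD, OF g]
      obtain i where i: "i \<in> chains" "f i \<noteq> g i"
        using chain_product_ext[OF fP gP] ne by blast
      have u: "fst i \<in> X" "snd i \<in> X" "M.chain_between (fst i) (snd i)" using chainsD[OF i(1)] by simp_all
      define p q where "p = f i" and "q = g i"
      have p: "p \<in> X" "M.btw (fst i) p (snd i)" and q: "q \<in> X" "M.btw (fst i) q (snd i)"
        using chain_product_component[OF fP i(1)] chain_product_component[OF gP i(1)]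
        by (simp_all add: p_def q_def)
      have cont: "continuous_map ?K \<sigma> (\<lambda>h. h i)"
        unfolding chain_compactification_def
        by (rule continuous_map_from_subtopology) (rule continuous_chain_product_component[OF i(1)])
      have retract: "pointwise_median (chain_map p) h (chain_map q) = chain_map (m p (h i) q)"
        if h: "h \<in> topspace ?K" for h
      proof (rule forall_in_closure_of_eq[of h ?K "chain_map ` X" ?K, OF _ D.Hausdorff])
        show "h \<in> ?K closure_of (chain_map ` X)" using h by (simp add: D.dense)
        show "continuous_map ?K ?K (\<lambda>h. pointwise_median (chain_map p) h (chain_map q))"
          by (rule D.continuous_retraction) (use p q in simp_all)
        have "continuous_map ?K \<sigma> (\<lambda>h. m p (h i) q)"
          by (rule continuous_map_median[OF tma]) (use p q cont in simp_all)
        from continuous_map_compose[OF this D.continuous]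
        show "continuous_map ?K ?K (\<lambda>h. chain_map (m p (h i) q))" by (simp add: o_def)
        fix k assume "k \<in> chain_map ` X"
        then obtain x where x: "x \<in> X" "k = chain_map x" by blast
        have "m p (k i) q = m p (m (fst i) x (snd i)) q" using i x by (simp add: chain_map_def)
        also have "\<dots> = m p x q" by (rule M.retraction_absorb) (use u p q x in simp_all)
        finally show "pointwise_median (chain_map p) k (chain_map q) = chain_map (m p (k i) q)"
          using chain_map_median[of p x q] p q x by simp
      qed
      have "pointwise_median (chain_map p) f (chain_map q) = chain_map p"
        "pointwise_median (chain_map p) g (chain_map q) = chain_map q"
        using retract[OF f] retract[OF g] p q by (simp_all add: p_def[symmetric] q_def[symmetric])
      moreover have "M.chain_between p q" by (rule M.chain_between_subinterval[of "fst i" "snd i"]) (use u p q in simp_all)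
      moreover have "p \<noteq> q" using i by (simp add: p_def q_def)
      ultimately show "\<exists>a\<in>X. \<exists>b\<in>X. a \<noteq> b \<and> median_chain X m (median_interval X m a b) \<and>
          pointwise_median (chain_map a) f (chain_map b) = chain_map a \<and>
          pointwise_median (chain_map a) g (chain_map b) = chain_map b"
        using p q M.median_chain_iff_chain_between by (intro bexI[of _ p] bexI[of _ q]) simp_all
    qed
  qed
qed

end

section \<open>Proper median compactifications\<close>

lemma dense_median_map_if_proper:
  assumes "topological_median_algebra \<sigma> m"
    and "\<forall>x\<in>topspace \<sigma>. \<forall>y\<in>topspace \<sigma>. compactin \<sigma> (median_interval (topspace \<sigma>) m x y)"
    and K: "proper_median_compactification \<sigma> m K n \<eta>"
  shows "dense_median_map_compact_intervals \<sigma> m K n \<eta>"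
proof
  have "embedding_map \<sigma> K \<eta>" using K unfolding proper_median_compactification_def by blast
  then show "inj_on \<eta> (topspace \<sigma>)"
    unfolding embedding_map_def by (rule homeomorphic_imp_injective_map)
qed (use assms in \<open>simp_all add: proper_median_compactification_def median_compactification_def\<close>)

lemma separated_proper_compactification:
  assumes "separated_median_map \<sigma> m K n \<eta>" and "proper_median_compactification \<sigma> m K n \<eta>"
  shows "T2m (topspace \<sigma>) m" "\<sigma> = median_topology (topspace \<sigma>) m"
    "isomorphic_compactifications (topspace \<sigma>) K n \<eta>
       (mmc_topology (topspace \<sigma>) m) (mmc_median (topspace \<sigma>) m) (mmc_map (topspace \<sigma>) m)"
proof -
  interpret separated_median_map \<sigma> m K n \<eta> by (rule assms(1))
  show "T2m (topspace \<sigma>) m" by (rule T2m_source)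
  show "\<sigma> = median_topology (topspace \<sigma>) m"
    using embedding_iff_median_topology assms(2) unfolding proper_median_compactification_def by blast
  show "isomorphic_compactifications (topspace \<sigma>) K n \<eta>
       (mmc_topology (topspace \<sigma>) m) (mmc_median (topspace \<sigma>) m) (mmc_map (topspace \<sigma>) m)"
    by (rule isomorphic_to_mmc)
qed

text \<open>
  Every compactification separated by chains is isomorphic to the MMC; so it is enough that one
  exists for the MMC to be a proper compactification.
\<close>

lemma mmc_proper_if_median_topology:
  assumes tma: "topological_median_algebra \<sigma> m"
    and compact: "\<forall>x\<in>topspace \<sigma>. \<forall>y\<in>topspace \<sigma>. compactin \<sigma> (median_interval (topspace \<sigma>) m x y)"
    and eq: "\<sigma> = median_topology (topspace \<sigma>) m"
  shows "T2m (topspace \<sigma>) m"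
    "proper_median_compactification \<sigma> m
       (mmc_topology (topspace \<sigma>) m) (mmc_median (topspace \<sigma>) m) (mmc_map (topspace \<sigma>) m)"
proof -
  have "median_algebra (topspace \<sigma>) m" "Hausdorff_space \<sigma>"
    using tma unfolding topological_median_algebra_def by blast+
  then show T2: "T2m (topspace \<sigma>) m"
    using T2m_if_Hausdorff_median_topology[of "topspace \<sigma>" m] eq by metis
  interpret C: compact_interval_median_algebra \<sigma> m
    by unfold_locales (use tma T2 compact in auto)
  interpret separated_median_map \<sigma> m C.chain_compactification C.pointwise_median C.chain_map
    by (rule C.separated_chain_map)
  show "proper_median_compactification \<sigma> m
       (mmc_topology (topspace \<sigma>) m) (mmc_median (topspace \<sigma>) m) (mmc_map (topspace \<sigma>) m)"
    by (rule proper_median_compactification_mmc[OF eq])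
qed

lemma separated_if_T2m_compactification:
  assumes "topological_median_algebra \<sigma> m"
    and "\<forall>x\<in>topspace \<sigma>. \<forall>y\<in>topspace \<sigma>. compactin \<sigma> (median_interval (topspace \<sigma>) m x y)"
    and "proper_median_compactification \<sigma> m K n \<eta>" and "T2m (topspace K) n"
  shows "separated_median_map \<sigma> m K n \<eta>"
proof -
  interpret dense_median_map_compact_intervals \<sigma> m K n \<eta>
    by (rule dense_median_map_if_proper[OF assms(1-3)])
  show ?thesis by unfold_locales (rule chain_separated_if_T2m[OF assms(4)])
qed

lemma separated_if_finite_rank:
  assumes "topological_median_algebra \<sigma> m"
    and "\<forall>x\<in>topspace \<sigma>. \<forall>y\<in>topspace \<sigma>. compactin \<sigma> (median_interval (topspace \<sigma>) m x y)"
    and "proper_median_compactification \<sigma> m K n \<eta>" and "median_rank (topspace \<sigma>) m \<noteq> \<infinity>"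
  shows "separated_median_map \<sigma> m K n \<eta>"
proof -
  interpret dense_median_map_compact_intervals \<sigma> m K n \<eta>
    by (rule dense_median_map_if_proper[OF assms(1-3)])
  show ?thesis by unfold_locales (rule chain_separated_if_finite_rank[OF assms(4)])
qed

theorem proposition5p11:
  fixes \<sigma> :: "'a topology" and m :: "'a \<Rightarrow> 'a \<Rightarrow> 'a \<Rightarrow> 'a"
  assumes "topological_median_algebra \<sigma> m"
    and "\<forall>x\<in>topspace \<sigma>. \<forall>y\<in>topspace \<sigma>. compactin \<sigma> (median_interval (topspace \<sigma>) m x y)"
  shows
    "(\<forall>(K :: 'k topology) mK \<eta>.
        proper_median_compactification \<sigma> m K mK \<eta> \<and> T2m (topspace K) mK \<longrightarrow>
          T2m (topspace \<sigma>) m \<and> \<sigma> = median_topology (topspace \<sigma>) m \<and>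
          isomorphic_compactifications (topspace \<sigma>) K mK \<eta>
            (mmc_topology (topspace \<sigma>) m) (mmc_median (topspace \<sigma>) m) (mmc_map (topspace \<sigma>) m))
     \<and>
     (median_rank (topspace \<sigma>) m \<noteq> \<infinity> \<longrightarrow>
        (admits_proper_median_compactification \<sigma> m \<longleftrightarrow> \<sigma> = median_topology (topspace \<sigma>) m) \<and>
        ((\<exists>(K :: 'k topology) mK \<eta>. proper_median_compactification \<sigma> m K mK \<eta>) \<longrightarrow>
           \<sigma> = median_topology (topspace \<sigma>) m) \<and>
        (\<sigma> = median_topology (topspace \<sigma>) m \<longrightarrow>
           T2m (topspace \<sigma>) m \<and>
           proper_median_compactification \<sigma> m
             (mmc_topology (topspace \<sigma>) m) (mmc_median (topspace \<sigma>) m) (mmc_map (topspace \<sigma>) m) \<and>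
           (\<forall>(K :: 'k topology) mK \<eta>.
              proper_median_compactification \<sigma> m K mK \<eta> \<longrightarrow>
                isomorphic_compactifications (topspace \<sigma>) K mK \<eta>
                  (mmc_topology (topspace \<sigma>) m) (mmc_median (topspace \<sigma>) m)
                  (mmc_map (topspace \<sigma>) m))))"
  (is "?one \<and> (_ \<longrightarrow> ?admits \<and> ?top \<and> ?unique)")
proof
  show ?one
    using separated_if_T2m_compactification[OF assms] separated_proper_compactification by blast
  show "median_rank (topspace \<sigma>) m \<noteq> \<infinity> \<longrightarrow> ?admits \<and> ?top \<and> ?unique"
  proof
    assume rank: "median_rank (topspace \<sigma>) m \<noteq> \<infinity>"
    note sep = separated_if_finite_rank[OF assms _ rank]
    have 1: ?admits
      unfolding admits_proper_median_compactification_def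
      using separated_proper_compactification(2)[OF sep] mmc_proper_if_median_topology(2)[OF assms] by blast
    have 2: ?top using separated_proper_compactification(2)[OF sep] by blast
    have 3: ?unique
    proof (intro impI conjI)
      assume eq: "\<sigma> = median_topology (topspace \<sigma>) m"
      show "T2m (topspace \<sigma>) m" "proper_median_compactification \<sigma> m
          (mmc_topology (topspace \<sigma>) m) (mmc_median (topspace \<sigma>) m) (mmc_map (topspace \<sigma>) m)"
        by (rule mmc_proper_if_median_topology[OF assms eq])+
      show "\<forall>(K :: 'k topology) mK \<eta>. proper_median_compactification \<sigma> m K mK \<eta> \<longrightarrow>
          isomorphic_compactifications (topspace \<sigma>) K mK \<eta>
            (mmc_topology (topspace \<sigma>) m) (mmc_median (topspace \<sigma>) m) (mmc_map (topspace \<sigma>) m)"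
        using separated_proper_compactification(3)[OF sep] by blast
    qed
    from 1 2 3 show "?admits \<and> ?top \<and> ?unique" by (intro conjI)
  qed
qed

end
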